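(* Let $(X,d)$ be a metric space, let $\Phi:X\to\mathbb R\cup\{+\infty\}$ be a proper functional bounded from below, and let $\alpha,\beta\in(\inf_X\Phi,+\infty)$ with $\alpha<\beta$. Let $g:X\to\mathbb R\cup\{+\infty\}$ be an upper gradient of $\Phi$ such that $\{w\in X:\alpha<\Phi(w)\le\beta\}\subseteq\mathcal M(g)$. Assume that there exists $\sigma>0$ such that $$g(w)\ge\sigma\quad\text{for all } w\in X \text{ with } \alpha\le\Phi(w)\le\beta.$$ Then, for every $u\in X$ with $\Phi(u)\le\beta$, there exists an absolutely continuous curve $\eta:[0,1]\to X$ such that (a) $\eta(0)=u$; (b) $\Phi(\eta(1))\le\alpha$; (c) $d(u,\eta(t))\le\frac{t}{\sigma}\max\{0,\Phi(u)-\alpha\}$ for all $t\in[0,1]$.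
   Context: Notation: $\operatorname{dom}\Phi=\{u\in X:\Phi(u)<+\infty\}$; proper means $\operatorname{dom}\Phi\ne\emptyset$. The metric space is not assumed complete. Locally absolutely continuous curve: a curve $v:(0,+\infty)\to X$ for which there is a nonnegative $m\in L^1_{\mathrm{loc}}(0,+\infty)$ with $d(v(t),v(s))\le\int_s^t m(r)\,dr$ for all $0<s\le t$. For such a curve the metric derivative $|\dot v|(t):=\lim_{h\to0}\frac{d(v(t+h),v(t))}{|h|}$ exists for a.e. $t$ and belongs to $L^1_{\mathrm{loc}}(0,+\infty)$. A curve $\eta:[0,1]\to X$ is absolutely continuous if there is a nonnegative $m\in L^1(0,1)$ with $d(\eta(t),\eta(s))\le\int_s^t m(r)\,dr$ for all $0\le s\le t\le1$. (Strong) upper gradient of $\Phi$: a nonnegative function $g:X\to\mathbb R\cup\{+\infty\}$ such that for every locally absolutely continuous curve $v:(0,+\infty)\to X$ with values in $\operatorname{dom}\Phi$, the function $g\circ v$ is Borel measurable and $|\Phi(v(t))-\Phi(v(s))|\le\int_s^t g(v(r))\,|\dot v|(r)\,dr$ for all $0<s\le t$ (the right-hand side may be $+\infty$). "Upper gradient" always means strong upper gradient. Gradient flow of $\Phi$ with respect to an upper gradient $g$: a locally absolutely continuous curve $v:(0,+\infty)\to X$ such that (1) $v(t)\in\operatorname{dom}\Phi$ for all $t>0$; (2) $\Phi(v(t))-\Phi(v(s))\le-\frac12\int_s^t|\dot v|(r)^2\,dr-\frac12\int_s^t g(v(r))^2\,dr$ for all $s,t\in(0,+\infty)$ (integrals are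 oriented). $\mathcal M(g)$ is the set of all $u\in\operatorname{dom}\Phi$ for which there exists a gradient flow $v:(0,+\infty)\to X$ of $\Phi$ with respect to $g$ with $\lim_{t\to0^+}v(t)=u$ and $\lim_{t\to0^+}\Phi(v(t))=\Phi(u)$. *)

theory Defs
  imports "HOL-Analysis.Analysis"
begin

text \<open>
  A functional \<open>\<Phi> : X \<rightarrow> \<real> \<union> {+\<infinity>}\<close> is a function into \<^typ>\<open>ereal\<close>; the value \<open>-\<infinity>\<close> is
  excluded wherever \<open>\<Phi>\<close> is assumed bounded from below by a real number. Curves are total
  functions on the reals; only their values on \<open>(0, \<infinity>)\<close>, respectively \<open>[0, 1]\<close>, matter.
\<close>

definition eff_dom :: "('a \<Rightarrow> ereal) \<Rightarrow> 'a set" where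
  "eff_dom \<Phi> = {u. \<Phi> u < \<infinity>}"

definition loc_ac_curve :: "(real \<Rightarrow> 'a::metric_space) \<Rightarrow> bool" where
  "loc_ac_curve v \<longleftrightarrow>
     (\<exists>m :: real \<Rightarrow> real.
        (\<forall>r>0. 0 \<le> m r) \<and>
        (\<forall>s t. 0 < s \<and> s \<le> t \<longrightarrow> set_integrable lborel {s..t} m) \<and>
        (\<forall>s t. 0 < s \<and> s \<le> t \<longrightarrow> dist (v t) (v s) \<le> (LINT r:{s..t}|lborel. m r)))"

definition ac_curve :: "(real \<Rightarrow> 'a::metric_space) \<Rightarrow> bool" where
  "ac_curve \<eta> \<longleftrightarrow>
     (\<exists>m :: real \<Rightarrow> real.
        (\<forall>r\<in>{0..1}. 0 \<le> m r) \<and>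
        set_integrable lborel {0..1} m \<and>
        (\<forall>s t. 0 \<le> s \<and> s \<le> t \<and> t \<le> 1 \<longrightarrow> dist (\<eta> t) (\<eta> s) \<le> (LINT r:{s..t}|lborel. m r)))"

text \<open>
  For a locally absolutely continuous curve the limit exists at almost every \<open>t > 0\<close>. Elsewhere
  the value is arbitrary, which does not affect the integrals below.
\<close>

definition metric_deriv :: "(real \<Rightarrow> 'a::metric_space) \<Rightarrow> real \<Rightarrow> real" where
  "metric_deriv v t = Lim (at 0) (\<lambda>h. dist (v (t + h)) (v t) / \<bar>h\<bar>)"

text \<open>
  Nonnegative functions into \<open>\<real> \<union> {+\<infinity>}\<close> have type \<^typ>\<open>ennreal\<close>, with \<open>\<infinity> \<cdot> 0 = 0\<close> in products.
  Integrals of such functions are \<^const>\<open>nn_integral\<close>s, which may be infinite.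
\<close>

definition upper_gradient :: "('a::metric_space \<Rightarrow> ereal) \<Rightarrow> ('a \<Rightarrow> ennreal) \<Rightarrow> bool" where
  "upper_gradient \<Phi> g \<longleftrightarrow>
     (\<forall>v. loc_ac_curve v \<and> (\<forall>t>0. v t \<in> eff_dom \<Phi>) \<longrightarrow>
        (\<lambda>t. g (v t)) \<in> borel_measurable (restrict_space borel {0<..}) \<and>
        (\<forall>s t. 0 < s \<and> s \<le> t \<longrightarrow>
           \<bar>\<Phi> (v t) - \<Phi> (v s)\<bar>
             \<le> enn2ereal (\<integral>\<^sup>+ r\<in>{s..t}. (g (v r) * ennreal (metric_deriv v r)) \<partial>lborel)))"

text \<open>
  The oriented integral of a nonnegative function. The library's \<open>LBINT r=s..t\<close> is not suitable
  here, as it assigns the value 0 to integrals that diverge to infinity.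
\<close>

definition oriented_integral :: "real \<Rightarrow> real \<Rightarrow> (real \<Rightarrow> ennreal) \<Rightarrow> ereal" where
  "oriented_integral s t f =
     (if s \<le> t then enn2ereal (\<integral>\<^sup>+ r\<in>{s..t}. f r \<partial>lborel)
      else - enn2ereal (\<integral>\<^sup>+ r\<in>{t..s}. f r \<partial>lborel))"

definition gradient_flow ::
  "('a::metric_space \<Rightarrow> ereal) \<Rightarrow> ('a \<Rightarrow> ennreal) \<Rightarrow> (real \<Rightarrow> 'a) \<Rightarrow> bool" where
  "gradient_flow \<Phi> g v \<longleftrightarrow>
     loc_ac_curve v \<and>
     (\<forall>t>0. v t \<in> eff_dom \<Phi>) \<and>
     (\<forall>s>0. \<forall>t>0. \<Phi> (v t) - \<Phi> (v s)
        \<le> - (oriented_integral s t (\<lambda>r. (ennreal (metric_deriv v r))\<^sup>2) / 2)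
          - oriented_integral s t (\<lambda>r. (g (v r))\<^sup>2) / 2)"

definition flow_start_points :: "('a::metric_space \<Rightarrow> ereal) \<Rightarrow> ('a \<Rightarrow> ennreal) \<Rightarrow> 'a set" where
  "flow_start_points \<Phi> g =
     {u \<in> eff_dom \<Phi>. \<exists>v. gradient_flow \<Phi> g v \<and>
        (v \<longlongrightarrow> u) (at_right 0) \<and> ((\<lambda>t. \<Phi> (v t)) \<longlongrightarrow> \<Phi> u) (at_right 0)}"

end

theory Submission imports Defs "HOL-Probability.Distribution_Functions" begin

text \<open>
  Along a gradient flow \<open>v\<close> starting at \<open>u\<close>, \<open>2 \<sigma> |v'| \<le> |v'|\<^sup>2 + g(v)\<^sup>2\<close> as long as \<open>\<Phi>(v) \<ge> \<alpha>\<close>, so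
  \<open>\<sigma> d(v(s), v(t)) \<le> \<Phi>(v(s)) - \<Phi>(v(t))\<close>. The energy decays at least linearly and is continuous
  by the upper gradient inequality, hence it reaches \<open>\<alpha>\<close> in finite time, and parametrizing \<open>v\<close> by
  the energy gives a Lipschitz curve with constant \<open>(\<Phi>(u) - \<alpha>) / \<sigma>\<close>.

  This needs \<open>d(v(s), v(t)) \<le> \<integral> |v'|\<close>, including the existence of \<open>|v'|\<close> almost everywhere. Let \<open>D\<close> be the
  lower limit of the right difference quotients \<open>d(v(x + h), v(x)) / h\<close>. Continuous induction gives
  \<open>d(v(s), v(t)) \<le> \<integral> D\<close>, because from every point some step to the right is possible. By Lebesgue's
  differentiation theorem the two-sided upper limits are then at most \<open>D\<close> almost everywhere.
  Applied also to the reversed curve, this shows that the limit exists.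
\<close>

section \<open>Lebesgue's differentiation theorem on the line\<close>

lemma closed_segment_eq_cball:
  fixes x h :: real
  shows "closed_segment x (x + h) = cball (x + h / 2) (\<bar>h\<bar> / 2)"
  by (auto simp: closed_segment_eq_real_ivl cball_eq_atLeastAtMost field_simps)

lemma emeasure_density_negligible:
  fixes A :: "real set"
  assumes "f \<in> borel_measurable borel" "A \<in> sets borel" "negligible A"
  shows "emeasure (density lborel f) A = 0"
proof -
  have "A \<in> null_sets lborel"
    using assms(2,3) by (simp add: negligible_iff_null_sets null_sets_completion_iff)
  then have "A \<in> null_sets (density lborel f)"
    using assms(1,2) by (auto simp: null_sets_density_iff dest: AE_not_in)
  then show ?thesis by auto
qed

text \<open>The segments supplied by \<open>small\<close> cover \<open>A\<close> finely. Inside an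
  open \<open>U\<close> containing \<open>A\<close>, Vitali's theorem extracts countably many
  disjoint ones that exhaust \<open>A\<close> up to a null set; summing over them bounds the first
  measure of \<open>A\<close> by the second measure of \<open>U\<close>. Outer regularity of the
  second measure, finite by \<open>fin\<close>, then replaces \<open>U\<close> by
  \<open>A\<close>.\<close>

lemma vitali_density_le:
  fixes f1 f2 :: "real \<Rightarrow> ennreal" and A :: "real set"
  assumes meas: "f1 \<in> borel_measurable borel" "f2 \<in> borel_measurable borel" "A \<in> sets borel"
    and fin: "(\<integral>\<^sup>+x. f2 x \<partial>lborel) < \<infinity>"
    and small: "\<And>x d. x \<in> A \<Longrightarrow> d > 0 \<Longrightarrow> \<exists>h. h \<noteq> 0 \<and> \<bar>h\<bar> < d \<and>
        emeasure (density lborel f1) (closed_segment x (x + h))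
        \<le> emeasure (density lborel f2) (closed_segment x (x + h))"
  shows "emeasure (density lborel f1) A \<le> emeasure (density lborel f2) A"
proof -
  let ?N1 = "density lborel f1" and ?N2 = "density lborel f2"
  note [measurable] = meas
  have le_open: "emeasure ?N1 A \<le> emeasure ?N2 U" if U: "open U" "A \<subseteq> U" for U
  proof -
    \<comment> \<open>Each segment has \<open>x\<close> as an endpoint and \<open>h\<close> may be
      negative, so pairs \<open>(x, h)\<close> index balls centred at the midpoint; Vitali's theorem
      asks only that \<open>x\<close> lie in the closed ball.\<close>
    define J where "J = (\<lambda>(x, h). cball (x + h / 2) (\<bar>h\<bar> / 2 :: real))"
    have J_eq: "J (x, h) = closed_segment x (x + h)" for x h
      by (simp add: J_def closed_segment_eq_cball)
    define K where "K = {p. snd p \<noteq> 0 \<and> J p \<subseteq> U \<and> emeasure ?N1 (J p) \<le> emeasure ?N2 (J p)}"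
    have cov: "\<exists>p. p \<in> K \<and> x \<in> cball (fst p + snd p / 2) (\<bar>snd p\<bar> / 2) \<and> \<bar>snd p\<bar> / 2 < d"
      if x: "x \<in> A" and d: "d > 0" for x d
    proof -
      obtain e where e: "e > 0" "cball x e \<subseteq> U"
        using x U open_contains_cball by blast
      obtain h where h: "h \<noteq> 0" "\<bar>h\<bar> < min d e"
        "emeasure ?N1 (closed_segment x (x + h)) \<le> emeasure ?N2 (closed_segment x (x + h))"
        using small[OF x, of "min d e"] d e by auto
      have "closed_segment x (x + h) \<subseteq> cball x e"
        using h by (auto simp: closed_segment_eq_real_ivl cball_eq_atLeastAtMost)
      then have "(x, h) \<in> K"
        using h e by (auto simp: K_def J_eq)
      moreover have "x \<in> cball (x + h / 2) (\<bar>h\<bar> / 2)"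
        using J_eq[of x h] by (simp add: J_def)
      ultimately show ?thesis
        using h by (intro exI[of _ "(x, h)"]) auto
    qed
    obtain C where C: "countable C" "C \<subseteq> K"
      "pairwise (\<lambda>i j. disjnt (cball (fst i + snd i / 2) (\<bar>snd i\<bar> / 2))
                             (cball (fst j + snd j / 2) (\<bar>snd j\<bar> / 2))) C"
      "negligible (A - (\<Union>i \<in> C. cball (fst i + snd i / 2) (\<bar>snd i\<bar> / 2)))"
    proof (rule Vitali_covering_theorem_cballs[of K "\<lambda>p. \<bar>snd p\<bar> / 2" A "\<lambda>p. fst p + snd p / 2"])
      show "0 < \<bar>snd i\<bar> / 2" if "i \<in> K" for i
        using that by (simp add: K_def)
    qed (use cov in simp_all)
    have J_cball: "J p = cball (fst p + snd p / 2) (\<bar>snd p\<bar> / 2)" for p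
      by (simp add: J_def case_prod_unfold)
    have disj: "disjoint_family_on J C"
      using C(3) by (simp add: disjoint_family_on_def pairwise_def disjnt_def J_cball)
    have neg: "negligible (A - \<Union>(J ` C))"
      using C(4) by (simp add: J_cball)
    have J_meas: "J p \<in> sets borel" for p
      by (simp add: J_cball)
    have UJ: "\<Union>(J ` C) \<in> sets borel"
      using C(1) J_meas by auto
    have "emeasure ?N1 A \<le> emeasure ?N1 (\<Union>(J ` C) \<union> (A - \<Union>(J ` C)))"
      using UJ meas by (intro emeasure_mono) auto
    also have "\<dots> \<le> emeasure ?N1 (\<Union>(J ` C)) + emeasure ?N1 (A - \<Union>(J ` C))"
      using UJ meas by (intro emeasure_subadditive) auto
    also have "emeasure ?N1 (A - \<Union>(J ` C)) = 0"
      using UJ neg by (intro emeasure_density_negligible) auto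
    also have "emeasure ?N1 (\<Union>(J ` C)) = (\<integral>\<^sup>+p. emeasure ?N1 (J p) \<partial>count_space C)"
      using J_meas C(1) disj by (intro emeasure_UN_countable) auto
    also have "\<dots> \<le> (\<integral>\<^sup>+p. emeasure ?N2 (J p) \<partial>count_space C)"
      using C(2) by (intro nn_integral_mono) (auto simp: K_def)
    also have "\<dots> = emeasure ?N2 (\<Union>(J ` C))"
      using J_meas C(1) disj by (intro emeasure_UN_countable[symmetric]) auto
    also have "\<dots> \<le> emeasure ?N2 U"
      using C(2) U by (intro emeasure_mono) (auto simp: K_def)
    finally show ?thesis by simp
  qed
  have "emeasure ?N1 A \<le> (INF U \<in> {U. A \<subseteq> U \<and> open U}. emeasure ?N2 U)"
    using le_open by (simp add: le_INF_iff)
  also have "\<dots> = emeasure ?N2 A"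
  proof (rule outer_regular[symmetric])
    show "emeasure ?N2 (space ?N2) \<noteq> \<infinity>"
      using fin by (subst emeasure_density) auto
  qed (use meas in auto)
  finally show ?thesis .
qed

text \<open>The conjunct \<open>F a \<le> F b\<close> carries information of its own:
  \<open>ennreal\<close> sends negative reals to 0, so the integral identity alone would let
  \<open>F\<close> decrease where the integral of \<open>f\<close> vanishes.\<close>

definition primitive_of :: "(real \<Rightarrow> ennreal) \<Rightarrow> (real \<Rightarrow> real) \<Rightarrow> bool" where
  "primitive_of f F \<longleftrightarrow> f \<in> borel_measurable borel \<and> (\<integral>\<^sup>+x. f x \<partial>lborel) < \<infinity> \<and> continuous_on UNIV F \<and>
     (\<forall>a b. a \<le> b \<longrightarrow> F a \<le> F b \<and> (\<integral>\<^sup>+x\<in>{a..b}. f x \<partial>lborel) = ennreal (F b - F a))"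

text \<open>\<open>F\<close> is the distribution function of the finite measure with density
  \<open>f\<close>. This measure has no atoms, which makes \<open>F\<close> continuous and half-open
  intervals interchangeable with closed ones.\<close>

lemma primitive_exists:
  assumes f: "f \<in> borel_measurable borel" "(\<integral>\<^sup>+x. f x \<partial>lborel) < \<infinity>"
  shows "\<exists>F. primitive_of f F"
proof -
  note [measurable] = f(1)
  let ?N = "density lborel f"
  have "finite_measure ?N"
  proof (rule finite_measureI)
    show "emeasure ?N (space ?N) \<noteq> \<infinity>"
      using f by (subst emeasure_density) auto
  qed
  then interpret finite_borel_measure ?N
    by (intro finite_borel_measure.intro finite_borel_measure_axioms.intro) simp_all
  have sing: "measure ?N {x} = 0" for x
    using emeasure_density_negligible[of f "{x}"] f by (simp add: measure_def)
  have "continuous_on UNIV (cdf ?N)"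
    using sing by (simp add: continuous_on_eq_continuous_at isCont_cdf)
  moreover have "cdf ?N a \<le> cdf ?N b \<and> (\<integral>\<^sup>+x\<in>{a..b}. f x \<partial>lborel) = ennreal (cdf ?N b - cdf ?N a)"
    if "a \<le> b" for a b
  proof
    show "cdf ?N a \<le> cdf ?N b" using cdf_nondecreasing that by blast
    have "emeasure ?N {a..b} = emeasure ?N ({a<..b} \<union> {a})"
      using that by (intro arg_cong[of _ _ "emeasure ?N"]) auto
    also have "\<dots> = emeasure ?N {a<..b} + emeasure ?N {a}"
      by (subst plus_emeasure) auto
    also have "emeasure ?N {a} = 0"
      using f by (intro emeasure_density_negligible) auto
    also have "emeasure ?N {a<..b} = ennreal (measure ?N {a<..b})"
      by (rule emeasure_eq_measure)
    also have "measure ?N {a<..b} = cdf ?N b - cdf ?N a"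
      using that by (cases "a = b") (auto simp: cdf_diff_eq)
    finally show "(\<integral>\<^sup>+x\<in>{a..b}. f x \<partial>lborel) = ennreal (cdf ?N b - cdf ?N a)"
      by (simp add: emeasure_density)
  qed
  ultimately show ?thesis
    using f unfolding primitive_of_def by blast
qed

section \<open>Gaps between difference quotients and the density\<close>

lemma emeasure_density_ennreal_const_segment:
  fixes c x h :: real
  assumes "c \<ge> 0"
  shows "emeasure (density lborel (\<lambda>_. ennreal c)) (closed_segment x (x + h)) = ennreal (c * \<bar>h\<bar>)"
  using assms by (simp add: emeasure_density_const closed_segment_eq_real_ivl ennreal_mult)

lemma primitive_of_segment:
  assumes "primitive_of f F"
  shows "emeasure (density lborel f) (closed_segment x (x + h)) = ennreal \<bar>F (x + h) - F x\<bar>"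
proof -
  have f: "f \<in> borel_measurable lborel"
    using assms by (simp add: primitive_of_def)
  have *: "a \<le> b \<Longrightarrow> F a \<le> F b \<and> (\<integral>\<^sup>+x\<in>{a..b}. f x \<partial>lborel) = ennreal (F b - F a)" for a b
    using assms by (simp add: primitive_of_def)
  show ?thesis
  proof (cases "h \<ge> 0")
    case True
    then show ?thesis
      using *[of x "x + h"] f by (simp add: emeasure_density closed_segment_eq_real_ivl)
  next
    case False
    then show ?thesis
      using *[of "x + h" x] f by (simp add: emeasure_density closed_segment_eq_real_ivl)
  qed
qed

text \<open>The quantifier over uncountably many \<open>h\<close> does no harm to measurability: for
  fixed \<open>h\<close> the condition is open in \<open>x\<close>, and arbitrary unions of open
  sets are open.\<close>

lemma open_difference_quotient_greater:
  assumes "continuous_on UNIV F"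
  shows "open {x::real. \<exists>h::real. h \<noteq> 0 \<and> \<bar>h\<bar> < d \<and> q * \<bar>h\<bar> < \<bar>F (x + h) - F x :: real\<bar>}"
proof -
  have "{x::real. \<exists>h::real. h \<noteq> 0 \<and> \<bar>h\<bar> < d \<and> q * \<bar>h\<bar> < \<bar>F (x + h) - F x\<bar>}
    = (\<Union>h\<in>{h. h \<noteq> 0 \<and> \<bar>h\<bar> < d}. {x. q * \<bar>h\<bar> < \<bar>F (x + h) - F x\<bar>})"
    by auto
  moreover have "open {x. q * \<bar>h\<bar> < \<bar>F (x + h) - F x\<bar>}" for h
    by (intro open_Collect_less continuous_intros continuous_on_compose2[OF assms]) auto
  ultimately show ?thesis by auto
qed

lemma open_difference_quotient_less:
  assumes "continuous_on UNIV F"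
  shows "open {x::real. \<exists>h::real. h \<noteq> 0 \<and> \<bar>h\<bar> < d \<and> \<bar>F (x + h) - F x :: real\<bar> < p * \<bar>h\<bar>}"
proof -
  have "{x::real. \<exists>h::real. h \<noteq> 0 \<and> \<bar>h\<bar> < d \<and> \<bar>F (x + h) - F x\<bar> < p * \<bar>h\<bar>}
    = (\<Union>h\<in>{h. h \<noteq> 0 \<and> \<bar>h\<bar> < d}. {x. \<bar>F (x + h) - F x\<bar> < p * \<bar>h\<bar>})"
    by auto
  moreover have "open {x. \<bar>F (x + h) - F x\<bar> < p * \<bar>h\<bar>}" for h
    by (intro open_Collect_less continuous_intros continuous_on_compose2[OF assms]) auto
  ultimately show ?thesis by auto
qed

lemma emeasure_zero_if_density_gap:
  fixes A :: "real set"
  assumes "A \<in> sets borel" "emeasure lborel A < \<infinity>" "0 \<le> p" "p < q"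
    and "ennreal q * emeasure lborel A \<le> ennreal p * emeasure lborel A"
  shows "A \<in> null_sets lborel"
proof -
  obtain a where a: "emeasure lborel A = ennreal a" "a \<ge> 0"
    using assms(2) by (cases "emeasure lborel A") auto
  then have "ennreal (q * a) \<le> ennreal (p * a)"
    using assms by (simp add: ennreal_mult)
  then have "q * a \<le> p * a"
    using a assms by (simp add: ennreal_le_iff)
  then have "a = 0"
    using assms a by (simp add: mult_le_cancel_right)
  then show ?thesis
    using a assms by (auto intro: null_setsI)
qed

text \<open>Every point of the set starts arbitrarily short segments on which \<open>f\<close> has
  mean above \<open>q\<close>. Comparing the constant density \<open>q\<close> with \<open>f\<close>
  bounds \<open>q\<close> times the measure of the set by the integral of \<open>f\<close> over it,
  hence by \<open>p\<close> times that measure. The ball makes the measure finite, so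
  \<open>p < q\<close> forces it to be 0.\<close>

lemma null_upper_gap:
  assumes F: "primitive_of f F" and pq: "0 \<le> p" "p < q"
  shows "{x. f x < ennreal p} \<inter> (\<Inter>n. {x. \<exists>h. h \<noteq> 0 \<and> \<bar>h\<bar> < 1 / real (Suc n) \<and> q * \<bar>h\<bar> < \<bar>F (x + h) - F x\<bar>})
    \<inter> ball 0 R \<in> null_sets lborel" (is "?A \<in> _")
proof -
  have f[measurable]: "f \<in> borel_measurable borel" and cont: "continuous_on UNIV F"
    and fin: "(\<integral>\<^sup>+x. f x \<partial>lborel) < \<infinity>"
    using F by (auto simp: primitive_of_def)
  have [measurable]: "{x. \<exists>h. h \<noteq> 0 \<and> \<bar>h\<bar> < d \<and> q * \<bar>h\<bar> < \<bar>F (x + h) - F x\<bar>} \<in> sets borel" for d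
    by (intro borel_open open_difference_quotient_greater cont)
  have A: "?A \<in> sets borel" by measurable
  have "emeasure (density lborel (\<lambda>_. ennreal q)) ?A \<le> emeasure (density lborel f) ?A"
  proof (rule vitali_density_le[OF _ f A fin])
    fix x d :: real assume x: "x \<in> ?A" and d: "d > 0"
    obtain n where n: "1 / real (Suc n) < d"
      using d nat_approx_posE by (metis of_nat_Suc)
    obtain h where h: "h \<noteq> 0" "\<bar>h\<bar> < 1 / real (Suc n)" "q * \<bar>h\<bar> < \<bar>F (x + h) - F x\<bar>"
      using x by blast
    show "\<exists>h. h \<noteq> 0 \<and> \<bar>h\<bar> < d \<and> emeasure (density lborel (\<lambda>_. ennreal q)) (closed_segment x (x + h))
        \<le> emeasure (density lborel f) (closed_segment x (x + h))"
    proof (intro exI conjI)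
      show "emeasure (density lborel (\<lambda>_. ennreal q)) (closed_segment x (x + h))
        \<le> emeasure (density lborel f) (closed_segment x (x + h))"
        using pq h(3) by (simp add: primitive_of_segment[OF F] emeasure_density_ennreal_const_segment
            ennreal_leI)
    qed (use h n in auto)
  qed simp
  also have "\<dots> = (\<integral>\<^sup>+x\<in>?A. f x \<partial>lborel)"
    using A by (intro emeasure_density) auto
  also have "\<dots> \<le> (\<integral>\<^sup>+x\<in>?A. ennreal p \<partial>lborel)"
    by (intro nn_integral_mono) (auto simp: indicator_def)
  also have "\<dots> = ennreal p * emeasure lborel ?A"
    using A by (simp add: nn_integral_cmult_indicator)
  finally have "ennreal q * emeasure lborel ?A \<le> ennreal p * emeasure lborel ?A"
    using A by (simp add: emeasure_density_const)
  moreover have "emeasure lborel ?A < \<infinity>"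
    by (rule le_less_trans[OF emeasure_mono emeasure_lborel_ball_finite[of "0::real" R]]) auto
  ultimately show ?thesis
    using A pq by (intro emeasure_zero_if_density_gap[of _ p q]) auto
qed

text \<open>The comparison of \<open>null_upper_gap\<close> with the roles exchanged: the mean of
  \<open>f\<close> over short segments lies below \<open>p\<close>, although \<open>f\<close>
  exceeds \<open>q\<close> pointwise.\<close>

lemma null_lower_gap:
  assumes F: "primitive_of f F" and pq: "0 \<le> p" "p < q"
  shows "{x. ennreal q < f x} \<inter> (\<Inter>n. {x. \<exists>h. h \<noteq> 0 \<and> \<bar>h\<bar> < 1 / real (Suc n) \<and> \<bar>F (x + h) - F x\<bar> < p * \<bar>h\<bar>})
    \<inter> ball 0 R \<in> null_sets lborel" (is "?A \<in> _")
proof -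
  have f[measurable]: "f \<in> borel_measurable borel" and cont: "continuous_on UNIV F"
    using F by (auto simp: primitive_of_def)
  have [measurable]: "{x. \<exists>h. h \<noteq> 0 \<and> \<bar>h\<bar> < d \<and> \<bar>F (x + h) - F x\<bar> < p * \<bar>h\<bar>} \<in> sets borel" for d
    by (intro borel_open open_difference_quotient_less cont)
  have A: "?A \<in> sets borel" by measurable
  \<comment> \<open>\<open>vitali_density_le\<close> asks for a finite integral of the majorant, so
    the constant \<open>p\<close> is cut off outside the ball. Accordingly, segments are chosen to
    stay in the ball.\<close>
  define k where "k = (\<lambda>x::real. ennreal p * indicator (ball 0 R) x)"
  have k: "k \<in> borel_measurable borel"
    unfolding k_def
    by (intro borel_measurable_times_ennreal borel_measurable_const borel_measurable_indicator) auto
  have k_eq: "emeasure (density lborel k) B = ennreal p * emeasure lborel B"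
    if "B \<in> sets borel" "B \<subseteq> ball 0 R" for B
  proof -
    have "emeasure (density lborel k) B = (\<integral>\<^sup>+x\<in>B. k x \<partial>lborel)"
      using that k by (intro emeasure_density) auto
    also have "\<dots> = (\<integral>\<^sup>+x. ennreal p * indicator B x \<partial>lborel)"
      using that by (intro nn_integral_cong) (auto simp: k_def indicator_def)
    finally show ?thesis
      using that by (simp add: nn_integral_cmult_indicator)
  qed
  have "ennreal q * emeasure lborel ?A = (\<integral>\<^sup>+x\<in>?A. ennreal q \<partial>lborel)"
    using A by (simp add: nn_integral_cmult_indicator)
  also have "\<dots> \<le> (\<integral>\<^sup>+x\<in>?A. f x \<partial>lborel)"
    by (intro nn_integral_mono) (auto simp: indicator_def)
  also have "\<dots> = emeasure (density lborel f) ?A"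
    using A by (intro emeasure_density[symmetric]) auto
  also have "\<dots> \<le> emeasure (density lborel k) ?A"
  proof (rule vitali_density_le[OF f k A])
    have "(\<integral>\<^sup>+x. k x \<partial>lborel) = ennreal p * emeasure lborel (ball (0::real) R)"
      by (simp add: k_def nn_integral_cmult_indicator)
    also have "\<dots> < \<infinity>"
      using emeasure_lborel_ball_finite[of "0::real" R] by (simp add: ennreal_mult_less_top)
    finally show "(\<integral>\<^sup>+x. k x \<partial>lborel) < \<infinity>" .
    fix x d :: real assume x: "x \<in> ?A" and d: "d > 0"
    define d' where "d' = min d (R - \<bar>x\<bar>)"
    have "d' > 0" using x d by (auto simp: d'_def)
    then obtain n where n: "1 / real (Suc n) < d'"
      using nat_approx_posE by (metis of_nat_Suc)
    obtain h where h: "h \<noteq> 0" "\<bar>h\<bar> < 1 / real (Suc n)" "\<bar>F (x + h) - F x\<bar> < p * \<bar>h\<bar>"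
      using x by blast
    have sub: "closed_segment x (x + h) \<subseteq> ball 0 R"
      using h(2) n by (auto simp: d'_def closed_segment_eq_real_ivl)
    show "\<exists>h. h \<noteq> 0 \<and> \<bar>h\<bar> < d \<and> emeasure (density lborel f) (closed_segment x (x + h))
        \<le> emeasure (density lborel k) (closed_segment x (x + h))"
    proof (intro exI conjI)
      have "emeasure (density lborel k) (closed_segment x (x + h)) = ennreal (p * \<bar>h\<bar>)"
        using sub pq by (subst k_eq) (auto simp: closed_segment_eq_real_ivl ennreal_mult)
      then show "emeasure (density lborel f) (closed_segment x (x + h))
        \<le> emeasure (density lborel k) (closed_segment x (x + h))"
        using h(3) by (simp add: primitive_of_segment[OF F] ennreal_leI)
    qed (use h n in \<open>auto simp: d'_def\<close>)
  qed
  also have "\<dots> = ennreal p * emeasure lborel ?A"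
    using A by (intro k_eq) auto
  finally have "ennreal q * emeasure lborel ?A \<le> ennreal p * emeasure lborel ?A" .
  moreover have "emeasure lborel ?A < \<infinity>"
    by (rule le_less_trans[OF emeasure_mono emeasure_lborel_ball_finite[of "0::real" R]]) auto
  ultimately show ?thesis
    using A pq by (intro emeasure_zero_if_density_gap[of _ p q]) auto
qed

lemma primitive_of_AE_finite:
  assumes "primitive_of f F"
  shows "AE x in lborel. f x < \<infinity>"
proof -
  have "AE x in lborel. f x \<noteq> \<infinity>"
    using assms by (intro nn_integral_noteq_infinite) (auto simp: primitive_of_def)
  then show ?thesis
    by eventually_elim (simp add: less_top)
qed

lemma difference_quotient_mono:
  assumes "primitive_of f F" "h \<noteq> 0"
  shows "(F (x + h) - F x) / h = \<bar>F (x + h) - F x\<bar> / \<bar>h\<bar>"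
proof -
  have "a \<le> b \<Longrightarrow> F a \<le> F b" for a b
    using assms(1) by (simp add: primitive_of_def)
  from this[of x "x + h"] this[of "x + h" x] assms(2) show ?thesis
    by (cases "h > 0") (auto simp: field_simps)
qed

text \<open>Outside countably many null sets, indexed by rational \<open>p < q\<close> and balls of
  integer radius, no rational gap separates \<open>f x\<close> from the short difference quotients
  at \<open>x\<close>. Hence their lower and upper limits both equal \<open>f x\<close>.\<close>

lemma lebesgue_differentiation:
  assumes F: "primitive_of f F"
  shows "AE x in lborel. f x < \<infinity> \<and> (F has_real_derivative enn2real (f x)) (at x)"
proof -
  define U where "U p q R = {x. f x < ennreal p} \<inter> (\<Inter>n. {x. \<exists>h. h \<noteq> 0 \<and> \<bar>h\<bar> < 1 / real (Suc n)
      \<and> q * \<bar>h\<bar> < \<bar>F (x + h) - F x\<bar>}) \<inter> ball 0 R" for p q R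
  define L where "L p q R = {x. ennreal q < f x} \<inter> (\<Inter>n. {x. \<exists>h. h \<noteq> 0 \<and> \<bar>h\<bar> < 1 / real (Suc n)
      \<and> \<bar>F (x + h) - F x\<bar> < p * \<bar>h\<bar>}) \<inter> ball 0 R" for p q R
  have "AE x in lborel. 0 \<le> p \<and> p < q \<longrightarrow> x \<notin> U p q R \<and> x \<notin> L p q R" for p q R
    using null_upper_gap[OF F, of p q R] null_lower_gap[OF F, of p q R]
    by (cases "0 \<le> p \<and> p < q") (auto simp: U_def L_def dest!: AE_not_in)
  then have "AE x in lborel. \<forall>p\<in>\<rat>. \<forall>q\<in>\<rat>. \<forall>R::nat. 0 \<le> p \<and> p < q \<longrightarrow> x \<notin> U p q (real R) \<and> x \<notin> L p q (real R)"
    by (simp add: AE_ball_countable countable_rat AE_all_countable)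
  then show ?thesis
    using primitive_of_AE_finite[OF F]
  proof eventually_elim
    case (elim x)
    obtain c where c: "f x = ennreal c" "c \<ge> 0"
      using elim(2) by (cases "f x") auto
    obtain R :: nat where "\<bar>x\<bar> < real R"
      using reals_Archimedean2 by blast
    then have R: "x \<in> ball 0 (real R)" by simp
    have "((\<lambda>h. (F (x + h) - F x) / h) \<longlongrightarrow> c) (at 0)"
      unfolding order_tendsto_iff
    proof (intro conjI allI impI)
      fix l assume l: "l < c"
      show "\<forall>\<^sub>F h in at 0. l < (F (x + h) - F x) / h"
      proof (cases "l < 0")
        \<comment> \<open>The gap sets are restricted to \<open>p \<ge> 0\<close>; negative bounds
          hold because \<open>F\<close> is nondecreasing.\<close>
        case True
        have "\<forall>\<^sub>F h in at 0. h \<noteq> (0::real)"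
          by (simp add: eventually_at_filter)
        then show ?thesis
        proof eventually_elim
          case (elim h)
          have "0 \<le> \<bar>F (x + h) - F x\<bar> / \<bar>h\<bar>" by simp
          then show ?case
            using True difference_quotient_mono[OF F elim, of x] by linarith
        qed
      next
        case False
        obtain q where q: "q \<in> \<rat>" "l < q" "q < c" using Rats_dense_in_real[OF l] by blast
        obtain p where p: "p \<in> \<rat>" "l < p" "p < q" using Rats_dense_in_real[OF q(2)] by blast
        have "x \<notin> L p q (real R)"
          using elim(1) p q False by force
        moreover have "ennreal q < f x"
          using q p False c by (simp add: ennreal_less_iff)
        ultimately obtain n
          where "\<not> (\<exists>h. h \<noteq> 0 \<and> \<bar>h\<bar> < 1 / real (Suc n) \<and> \<bar>F (x + h) - F x\<bar> < p * \<bar>h\<bar>)"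
          using R unfolding L_def by blast
        then have n: "p * \<bar>h\<bar> \<le> \<bar>F (x + h) - F x\<bar>" if "h \<noteq> 0" "\<bar>h\<bar> < 1 / real (Suc n)" for h
          using that by (meson not_less)
        have "\<forall>\<^sub>F h in at 0. h \<noteq> 0 \<and> \<bar>h\<bar> < 1 / real (Suc n)"
          unfolding eventually_at by (intro exI[of _ "1 / real (Suc n)"]) auto
        then show ?thesis
        proof eventually_elim
          case (elim h)
          then have "p \<le> \<bar>F (x + h) - F x\<bar> / \<bar>h\<bar>"
            using n[of h] by (simp add: pos_le_divide_eq)
          then show ?case
            using p elim difference_quotient_mono[OF F, of h x] by simp
        qed
      qed
    next
      fix l assume l: "c < l"
      obtain q where q: "q \<in> \<rat>" "c < q" "q < l" using Rats_dense_in_real[OF l] by blast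
      obtain p where p: "p \<in> \<rat>" "c < p" "p < q" using Rats_dense_in_real[OF q(2)] by blast
      have "x \<notin> U p q (real R)"
        using elim(1) p q c by force
      moreover have "f x < ennreal p"
        using p c by (simp add: ennreal_less_iff)
      ultimately obtain n
          where "\<not> (\<exists>h. h \<noteq> 0 \<and> \<bar>h\<bar> < 1 / real (Suc n) \<and> q * \<bar>h\<bar> < \<bar>F (x + h) - F x\<bar>)"
          using R unfolding U_def by blast
        then have n: "\<bar>F (x + h) - F x\<bar> \<le> q * \<bar>h\<bar>" if "h \<noteq> 0" "\<bar>h\<bar> < 1 / real (Suc n)" for h
          using that by (meson not_less)
      have "\<forall>\<^sub>F h in at 0. h \<noteq> 0 \<and> \<bar>h\<bar> < 1 / real (Suc n)"
        unfolding eventually_at by (intro exI[of _ "1 / real (Suc n)"]) auto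
      then show "\<forall>\<^sub>F h in at 0. (F (x + h) - F x) / h < l"
      proof eventually_elim
        case (elim h)
        then have "\<bar>F (x + h) - F x\<bar> / \<bar>h\<bar> \<le> q"
          using n[of h] by (simp add: pos_divide_le_eq)
        then show ?case
          using q elim difference_quotient_mono[OF F, of h x] by simp
      qed
    qed
    then show ?case
      using c elim(2) by (simp add: DERIV_def)
  qed
qed

section \<open>Metric derivatives\<close>

text \<open>This is the lower limit of \<open>dist (w (x + h)) (w x) / h\<close> as \<open>h\<close>
  decreases to 0. A value below \<open>c\<close> yields, at every scale, at least one step to the
  right of slope less than \<open>c\<close>; a single step is all that continuous induction asks
  for.\<close>

definition lower_right_speed :: "(real \<Rightarrow> 'a::metric_space) \<Rightarrow> real \<Rightarrow> ennreal" where
  "lower_right_speed w x =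
     (SUP n. INF h\<in>{0<..<1 / real (Suc n)}. ennreal (dist (w (x + h)) (w x) / h))"

lemma lower_right_speed_measurable:
  assumes "continuous_on UNIV w"
  shows "lower_right_speed w \<in> borel_measurable borel"
proof -
  have "(\<lambda>x. INF h\<in>{0<..<1 / real (Suc n)}. ennreal (dist (w (x + h)) (w x) / h)) \<in> borel_measurable borel" for n
  proof (rule borel_measurableI_less)
    fix y :: ennreal
    have *: "{x \<in> space borel. (INF h\<in>{0<..<1 / real (Suc n)}. ennreal (dist (w (x + h)) (w x) / h)) < y}
      = (\<Union>h\<in>{0<..<1 / real (Suc n)}. {x. ennreal (dist (w (x + h)) (w x) / h) < y})"
      by (auto simp: INF_less_iff)
    have "open {x. ennreal (dist (w (x + h)) (w x) / h) < y}" if "h > 0" for h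
      using that
      by (intro open_Collect_less continuous_on_ennreal continuous_intros continuous_on_compose2[OF assms]) auto
    then have "open (\<Union>h\<in>{0<..<1 / real (Suc n)}. {x. ennreal (dist (w (x + h)) (w x) / h) < y})"
      by (intro open_UN) auto
    then show "{x \<in> space borel. (INF h\<in>{0<..<1 / real (Suc n)}. ennreal (dist (w (x + h)) (w x) / h)) < y} \<in> sets borel"
      unfolding * by (rule borel_open)
  qed
  then show ?thesis
    unfolding lower_right_speed_def[abs_def] by (intro borel_measurable_SUP) auto
qed

lemma lower_right_speed_lessD:
  assumes "lower_right_speed w x < ennreal c" "d > 0"
  obtains h where "0 < h" "h < d" "dist (w (x + h)) (w x) < c * h"
proof -
  obtain n where n: "1 / real (Suc n) < d"
    using assms(2) nat_approx_posE by blast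
  have "(INF h\<in>{0<..<1 / real (Suc n)}. ennreal (dist (w (x + h)) (w x) / h)) < ennreal c"
    using assms(1) unfolding lower_right_speed_def
    by (rule le_less_trans[OF SUP_upper, rotated]) simp
  then obtain h where h: "0 < h" "h < 1 / real (Suc n)" "ennreal (dist (w (x + h)) (w x) / h) < ennreal c"
    by (auto simp: INF_less_iff)
  then have "dist (w (x + h)) (w x) < c * h"
    by (simp add: ennreal_less_iff pos_divide_less_eq)
  then show thesis
    using h n by (intro that[of h]) linarith+
qed

lemma lower_right_speed_greaterD:
  assumes "ennreal c < lower_right_speed w x"
  obtains d where "d > 0" "\<And>h. 0 < h \<Longrightarrow> h < d \<Longrightarrow> c * h \<le> dist (w (x + h)) (w x)"
proof -
  obtain n where n: "ennreal c < (INF h\<in>{0<..<1 / real (Suc n)}. ennreal (dist (w (x + h)) (w x) / h))"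
    using assms unfolding lower_right_speed_def less_SUP_iff by blast
  show thesis
  proof (rule that[of "1 / real (Suc n)"])
    fix h assume h: "0 < h" "h < 1 / real (Suc n)"
    have "ennreal c < ennreal (dist (w (x + h)) (w x) / h)"
      by (rule less_le_trans[OF n INF_lower]) (use h in auto)
    then have "c \<le> dist (w (x + h)) (w x) / h"
      using h by (metis ennreal_leI not_le order_less_imp_le)
    then show "c * h \<le> dist (w (x + h)) (w x)"
      using h by (simp add: field_simps)
  qed simp
qed

lemma DERIV_quotient_bounds:
  fixes F :: "real \<Rightarrow> real"
  assumes "(F has_real_derivative c) (at x)" "e > 0"
  obtains d where "d > 0"
    "\<And>h. h \<noteq> 0 \<Longrightarrow> \<bar>h\<bar> < d \<Longrightarrow> c - e < (F (x + h) - F x) / h \<and> (F (x + h) - F x) / h < c + e"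
proof -
  have "\<forall>\<^sub>F h in at 0. dist ((F (x + h) - F x) / h) c < e"
    using assms unfolding DERIV_def by (intro tendstoD)
  then obtain d where d: "d > 0" "\<And>h. h \<noteq> 0 \<Longrightarrow> \<bar>h\<bar> < d \<Longrightarrow> \<bar>(F (x + h) - F x) / h - c\<bar> < e"
    unfolding eventually_at by (auto simp: dist_real_def)
  have "c - e < (F (x + h) - F x) / h \<and> (F (x + h) - F x) / h < c + e" if "h \<noteq> 0" "\<bar>h\<bar> < d" for h
    using d(2)[OF that] by linarith
  then show thesis
    using d(1) by (rule that[rotated])
qed

section \<open>Distance bounded by the integral of the lower right speed\<close>

context
  fixes w :: "real \<Rightarrow> 'a::metric_space" and m M
  assumes M: "primitive_of m M"
    and w: "\<forall>s t. s \<le> t \<longrightarrow> dist (w s) (w t) \<le> M t - M s"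
begin

lemma continuous_of_primitive: "continuous_on UNIV w"
  unfolding continuous_on_iff
proof (intro ballI allI impI)
  fix x e :: real assume "e > 0"
  then obtain d where d: "d > 0" "\<And>y. dist y x < d \<Longrightarrow> dist (M y) (M x) < e"
    using M unfolding primitive_of_def continuous_on_iff by (metis UNIV_I)
  have "dist (w y) (w x) \<le> dist (M y) (M x)" for y
    using w[rule_format, of x y] w[rule_format, of y x] by (cases "x \<le> y") (auto simp: dist_real_def dist_commute)
  then show "\<exists>d>0. \<forall>y\<in>UNIV. dist y x < d \<longrightarrow> dist (w y) (w x) < e"
    using d by (meson le_less_trans)
qed

text \<open>Quotients of \<open>w\<close> are dominated by those of \<open>M\<close>, which tend to
  \<open>m x\<close> almost everywhere. The bound makes the lower right speed integrable, so that it
  has a primitive of its own.\<close>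

lemma lower_right_speed_le_density: "AE x in lborel. lower_right_speed w x \<le> m x"
  using lebesgue_differentiation[OF M]
proof eventually_elim
  case (elim x)
  show ?case
  proof (rule ccontr)
    assume "\<not> lower_right_speed w x \<le> m x"
    then have "m x < lower_right_speed w x" by simp
    then obtain q where q: "m x < q" "q < lower_right_speed w x"
      using dense by blast
    then obtain b where b: "q = ennreal b" "b \<ge> 0"
      by (cases q) auto
    obtain a where a: "m x = ennreal a" "a \<ge> 0"
      using elim by (cases "m x") auto
    have ab: "a < b"
      using q a b by (simp add: ennreal_less_iff)
    obtain d1 where d1: "d1 > 0" "\<And>h. 0 < h \<Longrightarrow> h < d1 \<Longrightarrow> b * h \<le> dist (w (x + h)) (w x)"
      by (rule lower_right_speed_greaterD[OF q(2)[unfolded b(1)]]) (blast intro: that)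
    have "(M has_real_derivative a) (at x)"
      using elim a by simp
    then obtain d2 where d2: "d2 > 0" "\<And>h. h \<noteq> 0 \<Longrightarrow> \<bar>h\<bar> < d2 \<Longrightarrow>
        a - (b - a) < (M (x + h) - M x) / h \<and> (M (x + h) - M x) / h < a + (b - a)"
      using ab by (elim DERIV_quotient_bounds[of _ _ _ "b - a"]) auto
    define h where "h = min d1 d2 / 2"
    have h: "0 < h" "h < d1" "h < d2"
      using d1(1) d2(1) by (auto simp: h_def)
    have "b * h \<le> M (x + h) - M x"
      using d1(2)[OF h(1,2)] w[rule_format, of x "x + h"] h by (simp add: dist_commute)
    moreover have "M (x + h) - M x < b * h"
      using d2(2)[of h] h by (simp add: pos_divide_less_eq)
    ultimately show False by simp
  qed
qed

lemma lower_right_speed_primitive_exists: "\<exists>F. primitive_of (lower_right_speed w) F"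
proof (rule primitive_exists)
  show "lower_right_speed w \<in> borel_measurable borel"
    by (intro lower_right_speed_measurable continuous_of_primitive)
  have "(\<integral>\<^sup>+x. lower_right_speed w x \<partial>lborel) \<le> (\<integral>\<^sup>+x. m x \<partial>lborel)"
    by (intro nn_integral_mono_AE lower_right_speed_le_density)
  also have "\<dots> < \<infinity>"
    using M by (simp add: primitive_of_def)
  finally show "(\<integral>\<^sup>+x. lower_right_speed w x \<partial>lborel) < \<infinity>" .
qed

text \<open>Continuous induction from \<open>s\<close> to \<open>t\<close>. Where \<open>F\<close>
  has the lower right speed as derivative, some short right step of length \<open>h\<close> costs at
  most the increment of \<open>F\<close> plus \<open>e * h\<close>. The remaining null set may be
  uncountable, so steps from it are paid from a separate budget \<open>G\<close> of total at most
  \<open>e\<close>.\<close>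

lemma dist_le_lower_right_speed_aux:
  assumes F: "primitive_of (lower_right_speed w) F" and st: "s \<le> t" and e: "e > 0"
  shows "dist (w s) (w t) \<le> F t - F s + e * (t - s) + e"
proof -
  have m[measurable]: "m \<in> borel_measurable borel"
    using M by (simp add: primitive_of_def)
  obtain N where N: "{x. \<not> (lower_right_speed w x < \<infinity> \<and>
        (F has_real_derivative enn2real (lower_right_speed w x)) (at x))} \<subseteq> N"
      "emeasure lborel N = 0" "N \<in> sets borel"
    using AE_E[OF lebesgue_differentiation[OF F]] by auto
  have "negligible N"
    using N by (simp add: negligible_iff_null_sets null_sets_completion_iff null_sets_def)
  then have "emeasure (density lborel m) N = 0"
    using N m by (intro emeasure_density_negligible)
  moreover have "emeasure (density lborel m) N
      = (INF U \<in> {U. N \<subseteq> U \<and> open U}. emeasure (density lborel m) U)"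
  proof (rule outer_regular)
    show "emeasure (density lborel m) (space (density lborel m)) \<noteq> \<infinity>"
      using M by (subst emeasure_density) (auto simp: primitive_of_def)
  qed (use N in auto)
  ultimately have "(INF U \<in> {U. N \<subseteq> U \<and> open U}. emeasure (density lborel m) U) < ennreal e"
    using e by simp
  then obtain U where U: "N \<subseteq> U" "open U" "emeasure (density lborel m) U < ennreal e"
    by (auto simp: INF_less_iff)
  \<comment> \<open>On the null set \<open>N\<close>, where \<open>F\<close> gives no control, a step is paid for by the mass of \<open>m\<close> on \<open>U\<close>.\<close>
  define k where "k = (\<lambda>x. m x * indicator U x)"
  have U_meas[measurable]: "U \<in> sets borel" using U by auto
  have k_int: "(\<integral>\<^sup>+x. k x \<partial>lborel) < ennreal e"
    using U(3) by (simp add: k_def emeasure_density)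
  obtain G where G: "primitive_of k G"
    using primitive_exists[of k] k_int by (auto simp: k_def less_trans)
  have mono: "F a \<le> F b" "G a \<le> G b" "M a \<le> M b" if "a \<le> b" for a b
    using F G M that by (auto simp: primitive_of_def)
  have cont: "continuous_on UNIV F" "continuous_on UNIV G"
    using F G by (auto simp: primitive_of_def)
  have G_le: "G t - G s \<le> e"
  proof -
    have "ennreal (G t - G s) = (\<integral>\<^sup>+x\<in>{s..t}. k x \<partial>lborel)"
      using G st by (simp add: primitive_of_def)
    also have "\<dots> \<le> (\<integral>\<^sup>+x. k x \<partial>lborel)"
      by (intro nn_integral_mono) (auto simp: indicator_def)
    finally have "ennreal (G t - G s) \<le> ennreal e"
      using k_int by simp
    then show ?thesis using e by (simp add: ennreal_le_iff)
  qed
  \<comment> \<open>\<open>F\<close> and the slope \<open>e\<close> pay for the good points,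
    \<open>G\<close> for steps starting in \<open>N\<close>. All three summands are nondecreasing,
    so none hurts in the other case.\<close>
  define H where "H y = F y + e * y + G y" for y
  have step: "\<exists>h. 0 < h \<and> h < d \<and> dist (w x) (w (x + h)) \<le> H (x + h) - H x"
    if d: "d > 0" for x d
  proof (cases "x \<in> N")
    case True
    then obtain r where r: "r > 0" "cball x r \<subseteq> U"
      using U open_contains_cball by blast
    define h where "h = min r d / 2"
    have h: "0 < h" "h < r" "h < d"
      using r d by (auto simp: h_def)
    have sub: "{x..x + h} \<subseteq> U"
      using r h by (intro order_trans[OF _ r(2)]) (auto simp: cball_eq_atLeastAtMost)
    have "ennreal (M (x + h) - M x) = (\<integral>\<^sup>+y\<in>{x..x + h}. m y \<partial>lborel)"
      using M h by (simp add: primitive_of_def)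
    also have "\<dots> = (\<integral>\<^sup>+y\<in>{x..x + h}. k y \<partial>lborel)"
      using sub by (intro nn_integral_cong) (auto simp: k_def indicator_def)
    also have "\<dots> = ennreal (G (x + h) - G x)"
      using G h by (simp add: primitive_of_def)
    finally have "M (x + h) - M x = G (x + h) - G x"
      using h mono(2,3)[of x "x + h"] by simp
    moreover have "0 \<le> e * h" using e h by simp
    ultimately have "dist (w x) (w (x + h)) \<le> H (x + h) - H x"
      using w[rule_format, of x "x + h"] mono(1)[of x "x + h"] h by (simp add: H_def algebra_simps)
    then show ?thesis using h by blast
  next
    case False
    define c where "c = enn2real (lower_right_speed w x)"
    have good: "lower_right_speed w x < \<infinity>" "(F has_real_derivative c) (at x)"
      using False N(1) by (auto simp: c_def)
    obtain d1 where d1: "d1 > 0" "\<And>h. h \<noteq> 0 \<Longrightarrow> \<bar>h\<bar> < d1 \<Longrightarrow>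
        c - e / 2 < (F (x + h) - F x) / h \<and> (F (x + h) - F x) / h < c + e / 2"
      using good(2) e by (elim DERIV_quotient_bounds[of _ _ _ "e / 2"]) auto
    have "lower_right_speed w x < ennreal (c + e / 2)"
      using good(1) e unfolding c_def
      by (cases "lower_right_speed w x") (auto simp: ennreal_less_iff)
    then obtain h where h: "0 < h" "h < min d d1" "dist (w (x + h)) (w x) < (c + e / 2) * h"
      using d d1(1) by (elim lower_right_speed_lessD[where d = "min d d1"]) auto
    \<comment> \<open>The distance is below \<open>(c + e / 2) * h\<close> and \<open>F\<close>
      gains more than \<open>(c - e / 2) * h\<close>; the term \<open>e * y\<close> in
      \<open>H\<close> covers the difference \<open>e * h\<close>.\<close>
    have "(c - e / 2) * h < F (x + h) - F x"
      using d1(2)[of h] h by (simp add: pos_less_divide_eq)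
    then have "dist (w x) (w (x + h)) \<le> H (x + h) - H x"
      using h mono(2)[of x "x + h"] by (simp add: H_def algebra_simps dist_commute)
    then show ?thesis using h by auto
  qed
  \<comment> \<open>The closed condition gives \<open>S\<close> a largest element. If that element
    were below \<open>t\<close>, one more step would stay in \<open>S\<close> by the triangle
    inequality.\<close>
  define S where "S = {s..t} \<inter> {y. dist (w s) (w y) \<le> H y - H s}"
  have "closed {y. dist (w s) (w y) \<le> H y - H s}"
    unfolding H_def
    by (intro closed_Collect_le continuous_intros continuous_of_primitive cont)
  then have "compact S"
    unfolding S_def by (intro compact_Int_closed) auto
  moreover have "s \<in> S"
    using st by (simp add: S_def)
  ultimately obtain T where T: "T \<in> S" "\<And>y. y \<in> S \<Longrightarrow> y \<le> T"
    using compact_attains_sup[of S] by blast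
  have "T = t"
  proof (rule ccontr)
    assume "T \<noteq> t"
    then have "t - T > 0" using T(1) by (auto simp: S_def)
    then obtain h where h: "0 < h" "h < t - T" "dist (w T) (w (T + h)) \<le> H (T + h) - H T"
      using step by blast
    have "dist (w s) (w (T + h)) \<le> dist (w s) (w T) + dist (w T) (w (T + h))"
      by (rule dist_triangle)
    then have "T + h \<in> S"
      using T(1) h by (auto simp: S_def)
    then show False
      using T(2) h by fastforce
  qed
  then have "dist (w s) (w t) \<le> H t - H s"
    using T(1) by (simp add: S_def)
  then show ?thesis
    using G_le by (simp add: H_def algebra_simps)
qed

lemma dist_le_lower_right_speed:
  assumes F: "primitive_of (lower_right_speed w) F" and st: "s \<le> t"
  shows "dist (w s) (w t) \<le> F t - F s"
proof (rule field_le_epsilon)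
  fix e :: real assume e: "e > 0"
  \<comment> \<open>The summand 1 absorbs the separate error \<open>e\<close> of the auxiliary bound
    and keeps the denominator positive for \<open>s = t\<close>.\<close>
  define e' where "e' = e / (t - s + 1)"
  have "e' > 0" using e st by (simp add: e'_def)
  moreover have "e' * (t - s) + e' = e' * (t - s + 1)"
    by (simp add: algebra_simps)
  moreover have "e' * (t - s + 1) = e"
    using st by (simp add: e'_def)
  ultimately show "dist (w s) (w t) \<le> F t - F s + e"
    using dist_le_lower_right_speed_aux[OF F st, of e'] by linarith
qed

end

section \<open>Existence of the metric derivative by time reversal\<close>

lemma primitive_of_reflect:
  assumes "primitive_of m M"
  shows "primitive_of (\<lambda>x. m (- x)) (\<lambda>x. - M (- x))"
proof -
  have m[measurable]: "m \<in> borel_measurable borel" and cont: "continuous_on UNIV M"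
    and fin: "(\<integral>\<^sup>+x. m x \<partial>lborel) < \<infinity>"
    and M: "\<And>a b. a \<le> b \<Longrightarrow> M a \<le> M b \<and> (\<integral>\<^sup>+x\<in>{a..b}. m x \<partial>lborel) = ennreal (M b - M a)"
    using assms by (auto simp: primitive_of_def)
  have int: "(\<integral>\<^sup>+x. f (- x) \<partial>lborel) = (\<integral>\<^sup>+x. f x \<partial>lborel)"
    if "f \<in> borel_measurable borel" for f :: "real \<Rightarrow> ennreal"
    using nn_integral_real_affine[of f "-1" 0] that by simp
  have "(\<integral>\<^sup>+x\<in>{a..b}. m (- x) \<partial>lborel) = ennreal (M (- a) - M (- b))" if "a \<le> b" for a b
  proof -
    have "(\<integral>\<^sup>+x\<in>{a..b}. m (- x) \<partial>lborel) = (\<integral>\<^sup>+x. m (- x) * indicator {-b..-a} (- x) \<partial>lborel)"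
      by (intro nn_integral_cong) (auto simp: indicator_def)
    also have "\<dots> = (\<integral>\<^sup>+x\<in>{-b..-a}. m x \<partial>lborel)"
      by (rule int) measurable
    also have "\<dots> = ennreal (M (- a) - M (- b))"
      using M that by simp
    finally show ?thesis .
  qed
  moreover have "continuous_on UNIV (\<lambda>x. - M (- x))"
    by (intro continuous_intros continuous_on_compose2[OF cont]) auto
  moreover have "(\<lambda>x. m (- x)) \<in> borel_measurable borel"
    by measurable
  ultimately show ?thesis
    using fin M int[OF m] by (simp add: primitive_of_def)
qed

lemma AE_lborel_reflect:
  fixes P :: "real \<Rightarrow> bool"
  assumes "AE x in lborel. P x"
  shows "AE x in lborel. P (- x)"
proof -
  obtain N where N: "{x. \<not> P x} \<subseteq> N" "emeasure lborel N = 0" "N \<in> sets borel"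
    using AE_E[OF assms] by auto
  have "AE x in lborel. x \<notin> N"
    using N by (intro AE_not_in null_setsI) auto
  then have "AE x in lborel. 0 + (-1) * x \<notin> N"
    using N by (intro AE_borel_affine) auto
  then show ?thesis
    by eventually_elim (use N in auto)
qed

text \<open>For \<open>h\<close> of either sign, the quotients of \<open>w\<close> are at most those
  of the primitive \<open>F\<close> of the lower right speed, and these converge to that speed
  almost everywhere. So a one-sided lower limit bounds the two-sided upper limit.\<close>

lemma AE_dist_less_lower_right_speed:
  fixes w :: "real \<Rightarrow> 'a::metric_space"
  assumes M: "primitive_of m M" and w: "\<forall>s t. s \<le> t \<longrightarrow> dist (w s) (w t) \<le> M t - M s"
  shows "AE x in lborel. lower_right_speed w x < \<infinity> \<and> (\<forall>c. lower_right_speed w x < ennreal c \<longrightarrow>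
      (\<exists>d>0. \<forall>h. h \<noteq> 0 \<and> \<bar>h\<bar> < d \<longrightarrow> dist (w (x + h)) (w x) < c * \<bar>h\<bar>))"
proof -
  obtain F where F: "primitive_of (lower_right_speed w) F"
    using lower_right_speed_primitive_exists[OF M w] by blast
  show ?thesis
    using lebesgue_differentiation[OF F]
  proof eventually_elim
    case (elim x)
    have "\<exists>d>0. \<forall>h. h \<noteq> 0 \<and> \<bar>h\<bar> < d \<longrightarrow> dist (w (x + h)) (w x) < c * \<bar>h\<bar>"
      if c: "lower_right_speed w x < ennreal c" for c
    proof -
      obtain a where a: "lower_right_speed w x = ennreal a" "a \<ge> 0"
        using elim by (cases "lower_right_speed w x") auto
      then have "a < c"
        using c by (simp add: ennreal_less_iff)
      then obtain d where d: "d > 0" "\<And>h. h \<noteq> 0 \<Longrightarrow> \<bar>h\<bar> < d \<Longrightarrow>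
          a - (c - a) < (F (x + h) - F x) / h \<and> (F (x + h) - F x) / h < a + (c - a)"
        using DERIV_quotient_bounds[of F a x "c - a"] elim a by auto
      have "dist (w (x + h)) (w x) < c * \<bar>h\<bar>" if h: "h \<noteq> 0" "\<bar>h\<bar> < d" for h
      proof -
        have "dist (w (x + h)) (w x) \<le> \<bar>F (x + h) - F x\<bar>"
          using dist_le_lower_right_speed[OF M w F, of x "x + h"]
            dist_le_lower_right_speed[OF M w F, of "x + h" x]
          by (cases "h \<ge> 0") (auto simp: dist_commute)
        moreover have "\<bar>F (x + h) - F x\<bar> / \<bar>h\<bar> < c"
          using d(2)[OF h] difference_quotient_mono[OF F h(1), of x] by simp
        ultimately show ?thesis
          using h by (simp add: pos_divide_less_eq)
      qed
      then show ?thesis using d(1) by blast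
    qed
    then show ?case using elim by blast
  qed
qed

lemma lower_right_speed_le_if_dist_less:
  assumes "\<And>c. b < ennreal c \<Longrightarrow> \<exists>d>0. \<forall>h. h \<noteq> 0 \<and> \<bar>h\<bar> < d \<longrightarrow> dist (w (x + h)) (w x) < c * \<bar>h\<bar>"
  shows "lower_right_speed w x \<le> b"
proof (rule ccontr)
  assume "\<not> lower_right_speed w x \<le> b"
  then obtain q where q: "b < q" "q < lower_right_speed w x"
    using dense[of b "lower_right_speed w x"] by (auto simp: not_le)
  then obtain c where c: "q = ennreal c"
    by (cases q) auto
  obtain d1 where d1: "d1 > 0" "\<And>h. 0 < h \<Longrightarrow> h < d1 \<Longrightarrow> c * h \<le> dist (w (x + h)) (w x)"
    by (rule lower_right_speed_greaterD[OF q(2)[unfolded c]]) (blast intro: that)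
  obtain d2 where d2: "d2 > 0" "\<And>h. h \<noteq> 0 \<Longrightarrow> \<bar>h\<bar> < d2 \<Longrightarrow> dist (w (x + h)) (w x) < c * \<bar>h\<bar>"
    using assms[OF q(1)[unfolded c]] by blast
  define h where "h = min d1 d2 / 2"
  have h: "0 < h" "h < d1" "h < d2"
    using d1(1) d2(1) by (auto simp: h_def)
  show False
    using d1(2)[OF h(1,2)] d2(2)[of h] h by simp
qed

text \<open>Reversal turns right quotients into left ones. The lower right and the lower left speed
  each bound the two-sided upper limit and are themselves at most that limit, so they coincide with
  it, and the full limit exists.\<close>

lemma AE_metric_derivative:
  fixes w :: "real \<Rightarrow> 'a::metric_space"
  assumes M: "primitive_of m M" and w: "\<forall>s t. s \<le> t \<longrightarrow> dist (w s) (w t) \<le> M t - M s"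
  shows "AE x in lborel. lower_right_speed w x < \<infinity> \<and>
    ((\<lambda>h. dist (w (x + h)) (w x) / \<bar>h\<bar>) \<longlongrightarrow> enn2real (lower_right_speed w x)) (at 0)"
proof -
  define u where "u = (\<lambda>x. w (- x))"
  have u: "\<forall>s t. s \<le> t \<longrightarrow> dist (u s) (u t) \<le> - M (- t) - - M (- s)"
  proof (intro allI impI)
    fix s t :: real assume "s \<le> t"
    then show "dist (u s) (u t) \<le> - M (- t) - - M (- s)"
      using w[rule_format, of "- t" "- s"] by (simp add: u_def dist_commute)
  qed
  have "AE x in lborel. lower_right_speed u (- x) < \<infinity> \<and> (\<forall>c. lower_right_speed u (- x) < ennreal c \<longrightarrow>
      (\<exists>d>0. \<forall>h. h \<noteq> 0 \<and> \<bar>h\<bar> < d \<longrightarrow> dist (u (- x + h)) (u (- x)) < c * \<bar>h\<bar>))"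
    by (rule AE_lborel_reflect[OF AE_dist_less_lower_right_speed[OF primitive_of_reflect[OF M] u]])
  then show ?thesis
    using AE_dist_less_lower_right_speed[OF M w]
  proof eventually_elim
    case (elim x)
    have swap: "(\<exists>d>0. \<forall>h. h \<noteq> 0 \<and> \<bar>h\<bar> < d \<longrightarrow> dist (u (- x + h)) (u (- x)) < c * \<bar>h\<bar>)
      \<longleftrightarrow> (\<exists>d>0. \<forall>h. h \<noteq> 0 \<and> \<bar>h\<bar> < d \<longrightarrow> dist (w (x + h)) (w x) < c * \<bar>h\<bar>)" for c
    proof -
      have "(\<forall>h. h \<noteq> 0 \<and> \<bar>h\<bar> < d \<longrightarrow> dist (u (- x + h)) (u (- x)) < c * \<bar>h\<bar>)
        \<longleftrightarrow> (\<forall>h. h \<noteq> 0 \<and> \<bar>h\<bar> < d \<longrightarrow> dist (w (x + h)) (w x) < c * \<bar>h\<bar>)" for d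
      proof (intro iffI allI impI)
        fix h assume *: "\<forall>h. h \<noteq> 0 \<and> \<bar>h\<bar> < d \<longrightarrow> dist (u (- x + h)) (u (- x)) < c * \<bar>h\<bar>"
          and "h \<noteq> 0 \<and> \<bar>h\<bar> < d"
        then show "dist (w (x + h)) (w x) < c * \<bar>h\<bar>"
          using *[rule_format, of "- h"] by (simp add: u_def add.commute)
      next
        fix h assume *: "\<forall>h. h \<noteq> 0 \<and> \<bar>h\<bar> < d \<longrightarrow> dist (w (x + h)) (w x) < c * \<bar>h\<bar>"
          and "h \<noteq> 0 \<and> \<bar>h\<bar> < d"
        then show "dist (u (- x + h)) (u (- x)) < c * \<bar>h\<bar>"
          using *[rule_format, of "- h"] by (simp add: u_def add.commute)
      qed
      then show ?thesis by simp
    qed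
    have "lower_right_speed w x \<le> lower_right_speed u (- x)"
      using elim(1) swap by (intro lower_right_speed_le_if_dist_less) blast
    moreover have "lower_right_speed u (- x) \<le> lower_right_speed w x"
      using elim(2) swap by (intro lower_right_speed_le_if_dist_less) blast
    ultimately have eq: "lower_right_speed u (- x) = lower_right_speed w x"
      by (rule antisym[rotated])
    obtain a where a: "lower_right_speed w x = ennreal a" "a \<ge> 0"
      using elim(2) by (cases "lower_right_speed w x") auto
    have "((\<lambda>h. dist (w (x + h)) (w x) / \<bar>h\<bar>) \<longlongrightarrow> a) (at 0)"
      unfolding order_tendsto_iff
    proof (intro conjI allI impI)
      fix l assume l: "l < a"
      show "\<forall>\<^sub>F h in at 0. l < dist (w (x + h)) (w x) / \<bar>h\<bar>"
      proof (cases "l < 0")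
        case True
        then show ?thesis
          by (intro always_eventually allI less_le_trans[OF True]) simp
      next
        case False
        obtain k where k: "l < k" "k < a" using dense[OF l] by blast
        have k_less: "ennreal k < lower_right_speed w x" "ennreal k < lower_right_speed u (- x)"
          using k a False by (auto simp: eq ennreal_less_iff)
        obtain d1 where d1: "d1 > 0" "\<And>h. 0 < h \<Longrightarrow> h < d1 \<Longrightarrow> k * h \<le> dist (w (x + h)) (w x)"
          by (rule lower_right_speed_greaterD[OF k_less(1)]) (blast intro: that)
        \<comment> \<open>A right quotient of \<open>u\<close> at \<open>- x\<close> is a left
          quotient of \<open>w\<close> at \<open>x\<close>, which settles the case
          \<open>h < 0\<close>.\<close>
        obtain d2 where d2: "d2 > 0" "\<And>h. 0 < h \<Longrightarrow> h < d2 \<Longrightarrow> k * h \<le> dist (u (- x + h)) (u (- x))"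
          by (rule lower_right_speed_greaterD[OF k_less(2)]) (blast intro: that)
        have "l < dist (w (x + h)) (w x) / \<bar>h\<bar>" if h: "h \<noteq> 0" "\<bar>h\<bar> < min d1 d2" for h
        proof -
          have "k * \<bar>h\<bar> \<le> dist (w (x + h)) (w x)"
            using h d1(2)[of h] d2(2)[of "- h"] by (cases "h > 0") (auto simp: u_def add.commute)
          then have "k \<le> dist (w (x + h)) (w x) / \<bar>h\<bar>"
            using h by (simp add: pos_le_divide_eq)
          then show ?thesis using k by simp
        qed
        then show ?thesis
          unfolding eventually_at using d1(1) d2(1) by (intro exI[of _ "min d1 d2"]) auto
      qed
    next
      fix l assume "a < l"
      then have "lower_right_speed w x < ennreal l"
        using a by (simp add: ennreal_less_iff)
      then obtain d where d: "d > 0" "\<And>h. h \<noteq> 0 \<Longrightarrow> \<bar>h\<bar> < d \<Longrightarrow> dist (w (x + h)) (w x) < l * \<bar>h\<bar>"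
        using elim(2) by blast
      then have "dist (w (x + h)) (w x) / \<bar>h\<bar> < l" if "h \<noteq> 0" "\<bar>h\<bar> < d" for h
        using that by (simp add: pos_divide_less_eq)
      then show "\<forall>\<^sub>F h in at 0. dist (w (x + h)) (w x) / \<bar>h\<bar> < l"
        unfolding eventually_at using d(1) by (intro exI[of _ d]) auto
    qed
    then show ?case using a by simp
  qed
qed

text \<open>The function \<rho> is a Borel representative of the metric derivative on the interval,
  so later integrals of \<open>metric_deriv v\<close> go through almost-everywhere equality.
  Clamping time to \<open>{a..b}\<close> produces a curve on the whole line, to which the results on
  \<open>lower_right_speed\<close> apply.\<close>

lemma loc_ac_curve_metric_deriv:
  fixes v :: "real \<Rightarrow> 'a::metric_space"
  assumes v: "loc_ac_curve v" and ab: "0 < a" "a \<le> b"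
  obtains \<rho> where "\<rho> \<in> borel_measurable borel"
    "AE x in lborel. x \<in> {a..b} \<longrightarrow> ennreal (metric_deriv v x) = \<rho> x"
    "ennreal (dist (v a) (v b)) \<le> (\<integral>\<^sup>+x\<in>{a..b}. \<rho> x \<partial>lborel)"
proof -
  obtain m where m: "\<And>r. r > 0 \<Longrightarrow> 0 \<le> m r"
    "\<And>s t. 0 < s \<Longrightarrow> s \<le> t \<Longrightarrow> set_integrable lborel {s..t} m"
    "\<And>s t. 0 < s \<Longrightarrow> s \<le> t \<Longrightarrow> dist (v t) (v s) \<le> (LINT r:{s..t}|lborel. m r)"
    using v unfolding loc_ac_curve_def by blast
  define k where "k x = ennreal (indicator {a..b} x *\<^sub>R m x)" for x
  have int_k: "(\<integral>\<^sup>+x\<in>{s..t}. k x \<partial>lborel) = ennreal (LINT r:{s..t}|lborel. m r)"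
    if st: "a \<le> s" "s \<le> t" "t \<le> b" for s t
  proof -
    have "(\<integral>\<^sup>+x\<in>{s..t}. k x \<partial>lborel) = (\<integral>\<^sup>+x. ennreal (indicator {s..t} x *\<^sub>R m x) \<partial>lborel)"
      using st by (intro nn_integral_cong) (auto simp: k_def indicator_def)
    also have "\<dots> = ennreal (LINT r:{s..t}|lborel. m r)"
      unfolding set_lebesgue_integral_def
      using m(2)[of s t] m(1) st ab
      by (intro nn_integral_eq_integral) (auto simp: set_integrable_def indicator_def)
    finally show ?thesis .
  qed
  have k: "k \<in> borel_measurable borel"
    using m(2)[OF ab] unfolding k_def set_integrable_def by auto
  have "(\<integral>\<^sup>+x. k x \<partial>lborel) = (\<integral>\<^sup>+x\<in>{a..b}. k x \<partial>lborel)"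
    by (intro nn_integral_cong) (auto simp: k_def indicator_def)
  then have "(\<integral>\<^sup>+x. k x \<partial>lborel) < \<infinity>"
    using int_k[of a b] ab by simp
  then obtain M where M: "primitive_of k M"
    using primitive_exists[OF k] by blast
  have M_mono: "s \<le> t \<Longrightarrow> M s \<le> M t" for s t
    using M by (simp add: primitive_of_def)
  define w where "w x = v (max a (min b x))" for x
  have w: "\<forall>s t. s \<le> t \<longrightarrow> dist (w s) (w t) \<le> M t - M s"
  proof (intro allI impI)
    fix s t :: real assume st: "s \<le> t"
    define s' t' where "s' = max a (min b s)" and "t' = max a (min b t)"
    have s't': "a \<le> s'" "s' \<le> t'" "t' \<le> b"
      using st ab by (auto simp: s'_def t'_def)
    have ws: "w s = v s'" and wt: "w t = v t'"
      by (simp_all only: w_def s'_def t'_def)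
    show "dist (w s) (w t) \<le> M t - M s"
    proof (cases "s' = t'")
      case True
      then show "dist (w s) (w t) \<le> M t - M s"
        using M_mono[OF st] by (simp add: ws wt)
    next
      case False
      \<comment> \<open>If \<open>s\<close> were beyond \<open>b\<close> or \<open>t\<close> before
        \<open>a\<close>, both clamped times would coincide, which is the case already
        excluded.\<close>
      then have *: "s \<le> s'" "t' \<le> t"
        using s't' by (auto simp: s'_def t'_def max_def min_def split: if_splits)
      have "ennreal (LINT r:{s'..t'}|lborel. m r) = ennreal (M t' - M s')"
        using int_k[OF s't'] M s't' by (simp add: primitive_of_def)
      then have "(LINT r:{s'..t'}|lborel. m r) \<le> M t' - M s'"
        using M_mono[OF s't'(2)] by (cases "0 \<le> (LINT r:{s'..t'}|lborel. m r)") auto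
      then have "dist (w s) (w t) \<le> M t' - M s'"
        using m(3)[of s' t'] s't' ab by (simp add: ws wt dist_commute)
      then show ?thesis
        using M_mono[OF *(1)] M_mono[OF *(2)] by simp
    qed
  qed
  obtain F where F: "primitive_of (lower_right_speed w) F"
    using lower_right_speed_primitive_exists[OF M w] by blast
  show thesis
  proof (rule that[of "lower_right_speed w"])
    show "lower_right_speed w \<in> borel_measurable borel"
      using F by (simp add: primitive_of_def)
    \<comment> \<open>Clamping may alter the two-sided quotients at the endpoints, so these two
      points are discarded.\<close>
    have "AE x in lborel. x \<noteq> a" "AE x in lborel. x \<noteq> b"
      by (rule AE_lborel_singleton)+
    with AE_metric_derivative[OF M w]
    show "AE x in lborel. x \<in> {a..b} \<longrightarrow> ennreal (metric_deriv v x) = lower_right_speed w x"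
    proof eventually_elim
      case (elim x)
      show ?case
      proof
        assume "x \<in> {a..b}"
        then have x: "a < x" "x < b" using elim by auto
        define d where "d = min (x - a) (b - x)"
        have "d > 0" using x by (simp add: d_def)
        have "\<forall>\<^sub>F h in at (0::real). dist (w (x + h)) (w x) / \<bar>h\<bar> = dist (v (x + h)) (v x) / \<bar>h\<bar>"
          unfolding eventually_at
        proof (intro exI[of _ d] conjI ballI impI)
          fix h :: real assume "h \<noteq> 0 \<and> dist h 0 < d"
          then have "max a (min b (x + h)) = x + h" "max a (min b x) = x"
            using x by (auto simp: d_def)
          then show "dist (w (x + h)) (w x) / \<bar>h\<bar> = dist (v (x + h)) (v x) / \<bar>h\<bar>"
            by (simp add: w_def)
        qed (rule \<open>d > 0\<close>)
        from Lim_transform_eventually[OF conjunct2[OF elim(1)] this]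
        have "((\<lambda>h. dist (v (x + h)) (v x) / \<bar>h\<bar>) \<longlongrightarrow> enn2real (lower_right_speed w x)) (at 0)" .
        then have "metric_deriv v x = enn2real (lower_right_speed w x)"
          unfolding metric_deriv_def by (intro tendsto_Lim) auto
        then show "ennreal (metric_deriv v x) = lower_right_speed w x"
          using elim by simp
      qed
    qed
    have "dist (w a) (w b) \<le> F b - F a"
      by (rule dist_le_lower_right_speed[OF M w F ab(2)])
    then have "ennreal (dist (w a) (w b)) \<le> ennreal (F b - F a)"
      by (rule ennreal_leI)
    also have "\<dots> = (\<integral>\<^sup>+x\<in>{a..b}. lower_right_speed w x \<partial>lborel)"
      using F ab by (simp add: primitive_of_def)
    finally show "ennreal (dist (v a) (v b)) \<le> (\<integral>\<^sup>+x\<in>{a..b}. lower_right_speed w x \<partial>lborel)"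
      using ab by (simp add: w_def)
  qed
qed

section \<open>Gradient flows\<close>

lemma two_mult_le_sum_squares_ennreal:
  fixes a b :: ennreal
  shows "2 * (a * b) \<le> a\<^sup>2 + b\<^sup>2"
proof (cases "a = \<infinity> \<or> b = \<infinity>")
  case True
  then show ?thesis by (auto simp: power2_eq_square ennreal_top_mult ennreal_mult_top)
next
  case False
  then obtain x y where xy: "a = ennreal x" "x \<ge> 0" "b = ennreal y" "y \<ge> 0"
    by (cases a; cases b) auto
  have "ennreal (2 * (x * y)) \<le> ennreal (x\<^sup>2 + y\<^sup>2)"
    using sum_squares_bound[of x y] by (intro ennreal_leI) simp
  then show ?thesis
    using xy by (simp add: ennreal_mult ennreal_power)
qed

text \<open>Real energy values at both ends rule out infinite integrals, so the \<open>ereal\<close>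
  inequality can be read in the reals and rearranged there before moving to
  \<open>ennreal\<close>.\<close>

lemma gradient_flow_energy:
  assumes flow: "gradient_flow \<Phi> g v" and st: "0 < s" "s \<le> t"
    and val: "\<Phi> (v s) = ereal a" "\<Phi> (v t) = ereal b"
  shows "(\<integral>\<^sup>+r\<in>{s..t}. (ennreal (metric_deriv v r))\<^sup>2 \<partial>lborel) + (\<integral>\<^sup>+r\<in>{s..t}. (g (v r))\<^sup>2 \<partial>lborel)
      \<le> ennreal (2 * (a - b))" (is "?E + ?G \<le> _")
    and "b \<le> a"
proof -
  have le: "ereal b - ereal a \<le> - (enn2ereal ?E / 2) - enn2ereal ?G / 2"
  proof -
    have "\<Phi> (v t) - \<Phi> (v s) \<le> - (oriented_integral s t (\<lambda>r. (ennreal (metric_deriv v r))\<^sup>2) / 2)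
          - oriented_integral s t (\<lambda>r. (g (v r))\<^sup>2) / 2"
      using flow st by (simp add: gradient_flow_def)
    then show ?thesis
      unfolding val by (simp only: oriented_integral_def st(2) if_True)
  qed
  obtain x y where x: "?E = ennreal x" "x \<ge> 0" and y: "?G = ennreal y" "y \<ge> 0"
    using le by (cases ?E; cases ?G) auto
  have xy: "b - a \<le> - (x / 2) - y / 2"
    using le x y by (simp add: enn2ereal_ennreal)
  then show "b \<le> a" using x y by linarith
  have "x + y \<le> 2 * (a - b)" using xy by (simp add: field_simps)
  then show "?E + ?G \<le> ennreal (2 * (a - b))"
    using x y by (simp flip: ennreal_plus add: ennreal_leI)
qed

context
  fixes \<Phi> :: "'a::metric_space \<Rightarrow> ereal" and g :: "'a \<Rightarrow> ennreal" and v :: "real \<Rightarrow> 'a" and \<phi> :: "real \<Rightarrow> real"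
  assumes ug: "upper_gradient \<Phi> g" and flow: "gradient_flow \<Phi> g v"
    and \<phi>: "\<forall>t>0. \<Phi> (v t) = ereal (\<phi> t)"
begin

lemma loc_ac_flow: "loc_ac_curve v"
  using flow by (simp add: gradient_flow_def)

text \<open>The upper gradient property grants measurability of \<open>g\<close> along
  \<open>v\<close> on positive times; the cut-off from \<open>s > 0\<close> on gives a Borel
  function on the whole line.\<close>

lemma borel_measurable_gradient_flow:
  assumes "0 < s"
  shows "(\<lambda>r. g (v r) * indicator {s..t} r) \<in> borel_measurable borel"
proof -
  have "(\<lambda>r. g (v r)) \<in> borel_measurable (restrict_space borel {0<..})"
    using ug flow by (simp add: upper_gradient_def gradient_flow_def)
  then have [measurable]: "(\<lambda>r. g (v r) * indicator {0<..} r) \<in> borel_measurable borel"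
    by (subst (asm) borel_measurable_restrict_space_iff_ennreal) auto
  have "(\<lambda>r. (g (v r) * indicator {0<..} r) * indicator {s..t} r) \<in> borel_measurable borel"
    by measurable
  also have "(\<lambda>r. (g (v r) * indicator {0<..} r) * indicator {s..t} r) = (\<lambda>r. g (v r) * indicator {s..t} r)"
    using assms by (auto simp: indicator_def fun_eq_iff)
  finally show ?thesis .
qed

lemma flow_nonincreasing:
  assumes "0 < s" "s \<le> t"
  shows "\<phi> t \<le> \<phi> s"
  using gradient_flow_energy(2)[OF flow assms] \<phi> assms by simp

text \<open>Merging the two integrals of the flow inequality into one uses additivity for measurable
  integrands, so the metric derivative enters through its representative \<rho>.\<close>

lemma flow_energy_integral:
  assumes st: "0 < s" "s \<le> t"
  obtains \<rho> where "\<rho> \<in> borel_measurable borel"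
    "AE r in lborel. r \<in> {s..t} \<longrightarrow> ennreal (metric_deriv v r) = \<rho> r"
    "ennreal (dist (v s) (v t)) \<le> (\<integral>\<^sup>+r\<in>{s..t}. \<rho> r \<partial>lborel)"
    "(\<integral>\<^sup>+r\<in>{s..t}. ((\<rho> r)\<^sup>2 + (g (v r))\<^sup>2) \<partial>lborel) \<le> ennreal (2 * (\<phi> s - \<phi> t))"
proof -
  obtain \<rho> where \<rho>[measurable]: "\<rho> \<in> borel_measurable borel"
    and ae: "AE r in lborel. r \<in> {s..t} \<longrightarrow> ennreal (metric_deriv v r) = \<rho> r"
    and dist: "ennreal (dist (v s) (v t)) \<le> (\<integral>\<^sup>+r\<in>{s..t}. \<rho> r \<partial>lborel)"
    using loc_ac_curve_metric_deriv[OF loc_ac_flow st] by blast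
  have [measurable]: "(\<lambda>r. g (v r) * indicator {s..t} r) \<in> borel_measurable borel"
    by (rule borel_measurable_gradient_flow[OF st(1)])
  have "(\<integral>\<^sup>+r\<in>{s..t}. ((\<rho> r)\<^sup>2 + (g (v r))\<^sup>2) \<partial>lborel)
      = (\<integral>\<^sup>+r. (\<rho> r)\<^sup>2 * indicator {s..t} r + (g (v r) * indicator {s..t} r)\<^sup>2 \<partial>lborel)"
    by (intro nn_integral_cong) (auto simp: indicator_def)
  also have "\<dots> = (\<integral>\<^sup>+r\<in>{s..t}. (\<rho> r)\<^sup>2 \<partial>lborel) + (\<integral>\<^sup>+r. (g (v r) * indicator {s..t} r)\<^sup>2 \<partial>lborel)"
    by (intro nn_integral_add) measurable
  also have "(\<integral>\<^sup>+r\<in>{s..t}. (\<rho> r)\<^sup>2 \<partial>lborel) = (\<integral>\<^sup>+r\<in>{s..t}. (ennreal (metric_deriv v r))\<^sup>2 \<partial>lborel)"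
    using ae by (intro nn_integral_cong_AE) (auto simp: indicator_def)
  also have "(\<integral>\<^sup>+r. (g (v r) * indicator {s..t} r)\<^sup>2 \<partial>lborel) = (\<integral>\<^sup>+r\<in>{s..t}. (g (v r))\<^sup>2 \<partial>lborel)"
    by (intro nn_integral_cong) (auto simp: indicator_def)
  also have "(\<integral>\<^sup>+r\<in>{s..t}. (ennreal (metric_deriv v r))\<^sup>2 \<partial>lborel) + (\<integral>\<^sup>+r\<in>{s..t}. (g (v r))\<^sup>2 \<partial>lborel)
      \<le> ennreal (2 * (\<phi> s - \<phi> t))"
    using gradient_flow_energy(1)[OF flow st] \<phi> st by simp
  finally show thesis
    using that \<rho> ae dist by blast
qed

lemma flow_dist_le:
  assumes st: "0 < s" "s \<le> t" and \<sigma>: "\<sigma> > 0" "\<And>r. r \<in> {s..t} \<Longrightarrow> ennreal \<sigma> \<le> g (v r)"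
  shows "\<sigma> * dist (v s) (v t) \<le> \<phi> s - \<phi> t"
proof -
  obtain \<rho> where \<rho>[measurable]: "\<rho> \<in> borel_measurable borel"
    and dist: "ennreal (dist (v s) (v t)) \<le> (\<integral>\<^sup>+r\<in>{s..t}. \<rho> r \<partial>lborel)"
    and energy: "(\<integral>\<^sup>+r\<in>{s..t}. ((\<rho> r)\<^sup>2 + (g (v r))\<^sup>2) \<partial>lborel) \<le> ennreal (2 * (\<phi> s - \<phi> t))"
    using flow_energy_integral[OF st] by blast
  have "ennreal (2 * \<sigma> * dist (v s) (v t)) = ennreal (2 * \<sigma>) * ennreal (dist (v s) (v t))"
    using \<sigma> by (simp add: ennreal_mult)
  also have "\<dots> \<le> ennreal (2 * \<sigma>) * (\<integral>\<^sup>+r\<in>{s..t}. \<rho> r \<partial>lborel)"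
    using dist by (rule mult_left_mono) simp
  also have "\<dots> = (\<integral>\<^sup>+r. ennreal (2 * \<sigma>) * (\<rho> r * indicator {s..t} r) \<partial>lborel)"
    by (rule nn_integral_cmult[symmetric]) measurable
  also have "\<dots> \<le> (\<integral>\<^sup>+r\<in>{s..t}. ((\<rho> r)\<^sup>2 + (g (v r))\<^sup>2) \<partial>lborel)"
  proof (rule nn_integral_mono)
    fix r
    have "ennreal (2 * \<sigma>) * \<rho> r \<le> (\<rho> r)\<^sup>2 + (g (v r))\<^sup>2" if "r \<in> {s..t}"
    proof -
      have "ennreal (2 * \<sigma>) * \<rho> r = 2 * (\<rho> r * ennreal \<sigma>)"
        using \<sigma>(1) by (simp add: ennreal_mult mult_ac)
      also have "\<dots> \<le> 2 * (\<rho> r * g (v r))"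
        using \<sigma>(2)[OF that] by (intro mult_left_mono) auto
      also have "\<dots> \<le> (\<rho> r)\<^sup>2 + (g (v r))\<^sup>2"
        by (rule two_mult_le_sum_squares_ennreal)
      finally show ?thesis .
    qed
    then show "ennreal (2 * \<sigma>) * (\<rho> r * indicator {s..t} r) \<le> ((\<rho> r)\<^sup>2 + (g (v r))\<^sup>2) * indicator {s..t} r"
      by (auto simp: indicator_def)
  qed
  also have "\<dots> \<le> ennreal (2 * (\<phi> s - \<phi> t))"
    by (rule energy)
  finally show ?thesis
    using flow_nonincreasing[OF st] by (simp add: ennreal_le_iff)
qed

text \<open>The speed term is dropped and \<open>g \<ge> \<sigma>\<close> is integrated over time.
  The resulting linear decay serves to show that the level \<alpha> is reached in finite
  time.\<close>

lemma flow_decrease: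
  assumes st: "0 < s" "s \<le> t" and \<sigma>: "\<sigma> > 0" "\<And>r. r \<in> {s..t} \<Longrightarrow> ennreal \<sigma> \<le> g (v r)"
  shows "\<sigma>\<^sup>2 * (t - s) \<le> 2 * (\<phi> s - \<phi> t)"
proof -
  have "ennreal (\<sigma>\<^sup>2 * (t - s)) = (\<integral>\<^sup>+r\<in>{s..t}. (ennreal \<sigma>)\<^sup>2 \<partial>lborel)"
    using st \<sigma> by (simp add: nn_integral_cmult_indicator ennreal_mult ennreal_power)
  also have "\<dots> \<le> (\<integral>\<^sup>+r\<in>{s..t}. (g (v r))\<^sup>2 \<partial>lborel)"
    using \<sigma>(2) by (intro nn_integral_mono) (auto simp: indicator_def intro: power_mono)
  also have "\<dots> \<le> (\<integral>\<^sup>+r\<in>{s..t}. (ennreal (metric_deriv v r))\<^sup>2 \<partial>lborel) + (\<integral>\<^sup>+r\<in>{s..t}. (g (v r))\<^sup>2 \<partial>lborel)"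
    by simp
  also have "\<dots> \<le> ennreal (2 * (\<phi> s - \<phi> t))"
    using gradient_flow_energy(1)[OF flow st] \<phi> st by simp
  finally show ?thesis
    using flow_nonincreasing[OF st] by (simp add: ennreal_le_iff)
qed

text \<open>The flow inequality makes the energy monotone but could leave jumps. The upper gradient
  inequality bounds its increments by the integral of \<open>g\<close> times the speed, hence by
  that of the sum of their squares. This is finite, and its primitive \<open>K\<close> controls the
  modulus of continuity.\<close>

lemma flow_continuous_on:
  assumes ab: "0 < a" "a \<le> b"
  shows "continuous_on {a..b} \<phi>"
proof -
  obtain \<rho> where \<rho>[measurable]: "\<rho> \<in> borel_measurable borel"
    and ae: "AE r in lborel. r \<in> {a..b} \<longrightarrow> ennreal (metric_deriv v r) = \<rho> r"
    and energy: "(\<integral>\<^sup>+r\<in>{a..b}. ((\<rho> r)\<^sup>2 + (g (v r))\<^sup>2) \<partial>lborel) \<le> ennreal (2 * (\<phi> a - \<phi> b))"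
    using flow_energy_integral[OF ab] by blast
  have [measurable]: "(\<lambda>r. g (v r) * indicator {a..b} r) \<in> borel_measurable borel"
    by (rule borel_measurable_gradient_flow[OF ab(1)])
  \<comment> \<open>The inner indicator secures measurability of \<open>g\<close> along the curve,
    the outer one finite total mass.\<close>
  define k where "k = (\<lambda>r. ((\<rho> r)\<^sup>2 + (g (v r) * indicator {a..b} r)\<^sup>2) * indicator {a..b} r)"
  have "(\<integral>\<^sup>+r. k r \<partial>lborel) = (\<integral>\<^sup>+r\<in>{a..b}. ((\<rho> r)\<^sup>2 + (g (v r))\<^sup>2) \<partial>lborel)"
    by (intro nn_integral_cong) (auto simp: k_def indicator_def)
  also have "\<dots> < \<infinity>"
    using energy by (rule le_less_trans) simp
  finally have "(\<integral>\<^sup>+r. k r \<partial>lborel) < \<infinity>" .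
  moreover have "k \<in> borel_measurable borel"
    unfolding k_def by measurable
  ultimately obtain K where K: "primitive_of k K"
    using primitive_exists by blast
  have bound: "\<bar>\<phi> t - \<phi> s\<bar> \<le> K t - K s" if st: "a \<le> s" "s \<le> t" "t \<le> b" for s t
  proof -
    have "\<bar>\<Phi> (v t) - \<Phi> (v s)\<bar>
        \<le> enn2ereal (\<integral>\<^sup>+r\<in>{s..t}. (g (v r) * ennreal (metric_deriv v r)) \<partial>lborel)"
      using ug flow st ab by (simp add: upper_gradient_def gradient_flow_def)
    also have "(\<integral>\<^sup>+r\<in>{s..t}. (g (v r) * ennreal (metric_deriv v r)) \<partial>lborel)
        = (\<integral>\<^sup>+r\<in>{s..t}. (g (v r) * \<rho> r) \<partial>lborel)"
      using ae st by (intro nn_integral_cong_AE) (auto simp: indicator_def)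
    also have "\<dots> \<le> (\<integral>\<^sup>+r\<in>{s..t}. k r \<partial>lborel)"
    proof (rule nn_integral_mono)
      fix r
      have "g (v r) * \<rho> r \<le> 2 * (\<rho> r * g (v r))"
        using mult_right_mono[of 1 2 "\<rho> r * g (v r)"] by (simp add: mult_ac)
      also have "\<dots> \<le> (\<rho> r)\<^sup>2 + (g (v r))\<^sup>2"
        by (rule two_mult_le_sum_squares_ennreal)
      finally show "g (v r) * \<rho> r * indicator {s..t} r \<le> k r * indicator {s..t} r"
        using st by (auto simp: k_def indicator_def)
    qed
    also have "\<dots> = ennreal (K t - K s)"
      using K st by (simp add: primitive_of_def)
    finally have "\<bar>\<Phi> (v t) - \<Phi> (v s)\<bar> \<le> enn2ereal (ennreal (K t - K s))"
      by (simp add: less_eq_ennreal.rep_eq)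
    moreover have "K s \<le> K t"
      using K st by (simp add: primitive_of_def)
    ultimately show ?thesis
      using \<phi> st ab by (simp add: enn2ereal_ennreal)
  qed
  show ?thesis
    unfolding continuous_on_iff
  proof (intro ballI allI impI)
    fix x e :: real assume x: "x \<in> {a..b}" and "e > 0"
    then obtain d where d: "d > 0" "\<And>y. dist y x < d \<Longrightarrow> dist (K y) (K x) < e"
      using K unfolding primitive_of_def continuous_on_iff by (metis UNIV_I)
    have "dist (\<phi> y) (\<phi> x) \<le> dist (K y) (K x)" if "y \<in> {a..b}" for y
      using bound[of x y] bound[of y x] x that by (cases "x \<le> y") (auto simp: dist_real_def)
    then show "\<exists>d>0. \<forall>y\<in>{a..b}. dist y x < d \<longrightarrow> dist (\<phi> y) (\<phi> x) < e"
      using d by (meson le_less_trans)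
  qed
qed

end

section \<open>Reparametrization by the energy\<close>

lemma set_lebesgue_integral_const_interval:
  fixes L :: real
  assumes "s \<le> t"
  shows "(LINT r:{s..t}|lborel. L) = L * (t - s)"
  using assms by (simp add: set_lebesgue_integral_def mult.commute)

lemma ac_curve_lipschitz:
  fixes \<eta> :: "real \<Rightarrow> 'a::metric_space"
  assumes "L \<ge> 0" "\<And>s t. 0 \<le> s \<Longrightarrow> s \<le> t \<Longrightarrow> t \<le> 1 \<Longrightarrow> dist (\<eta> t) (\<eta> s) \<le> L * (t - s)"
  shows "ac_curve \<eta>"
  unfolding ac_curve_def
proof (intro exI[of _ "\<lambda>_. L"] conjI)
  show "set_integrable lborel {0..1::real} (\<lambda>_. L)"
    by (rule borel_integrable_atLeastAtMost') (rule continuous_on_const)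
qed (use assms in \<open>auto simp: set_lebesgue_integral_const_interval\<close>)

text \<open>The curve is run at a constant rate of energy loss: \<eta> at time \<tau> is a point of
  level \<open>p - \<tau> * (p - \<alpha>)\<close>, found by the intermediate value theorem.
  Distances are at most energy differences divided by \<sigma>, so the Lipschitz constant is
  \<open>(p - \<alpha>) / \<sigma>\<close>. The parameter \<open>r\<close> is returned to locate the
  endpoint on \<open>w\<close>.\<close>

lemma descent_curve:
  fixes w :: "real \<Rightarrow> 'a::metric_space" and \<psi> :: "real \<Rightarrow> real"
  assumes \<sigma>: "\<sigma> > 0" and T: "0 \<le> T" and cont: "continuous_on {0..T} \<psi>"
    and \<psi>: "\<psi> 0 = p" "\<psi> T = \<alpha>" "\<alpha> \<le> p"
    and w: "\<And>s t. 0 \<le> s \<Longrightarrow> s \<le> t \<Longrightarrow> t \<le> T \<Longrightarrow> \<sigma> * dist (w s) (w t) \<le> \<psi> s - \<psi> t"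
  obtains \<eta> :: "real \<Rightarrow> 'a" and r where "ac_curve \<eta>" "\<eta> 0 = w 0" "\<eta> 1 = w r" "r \<in> {0..T}" "\<psi> r = \<alpha>"
    "\<And>t. t \<in> {0..1} \<Longrightarrow> dist (w 0) (\<eta> t) \<le> t / \<sigma> * (p - \<alpha>)"
proof -
  have "\<exists>r. r \<in> {0..T} \<and> \<psi> r = p - \<tau> * (p - \<alpha>)" if "\<tau> \<in> {0..1}" for \<tau>
  proof -
    have "\<tau> * (p - \<alpha>) \<le> 1 * (p - \<alpha>)" "0 \<le> \<tau> * (p - \<alpha>)"
      using that \<psi>(3) by (intro mult_right_mono mult_nonneg_nonneg; simp)+
    then have "\<psi> T \<le> p - \<tau> * (p - \<alpha>)" "p - \<tau> * (p - \<alpha>) \<le> \<psi> 0"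
      using \<psi> by auto
    from IVT2'[OF this T cont] show ?thesis by auto
  qed
  then obtain r where r: "\<And>\<tau>. \<tau> \<in> {0..1} \<Longrightarrow> r \<tau> \<in> {0..T} \<and> \<psi> (r \<tau>) = p - \<tau> * (p - \<alpha>)"
    by metis
  have w_abs: "dist (w s) (w t) \<le> \<bar>\<psi> s - \<psi> t\<bar> / \<sigma>" if "s \<in> {0..T}" "t \<in> {0..T}" for s t
  proof -
    have "\<sigma> * dist (w s) (w t) \<le> \<bar>\<psi> s - \<psi> t\<bar>"
      using w[of s t] w[of t s] that by (cases "s \<le> t") (auto simp: dist_commute)
    then show ?thesis
      using \<sigma> by (simp add: pos_le_divide_eq mult.commute)
  qed
  \<comment> \<open>\<open>r\<close> need not be injective or continuous: \<open>w_abs\<close> makes \<open>w\<close> a Lipschitz function of \<open>\<psi>\<close>.\<close>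
  define \<eta> where "\<eta> \<tau> = w (r \<tau>)" for \<tau>
  have lip: "dist (\<eta> t) (\<eta> s) \<le> (p - \<alpha>) / \<sigma> * (t - s)" if "0 \<le> s" "s \<le> t" "t \<le> 1" for s t
  proof -
    have "\<psi> (r t) - \<psi> (r s) = - ((p - \<alpha>) * (t - s))"
      using r[of s] r[of t] that by (simp add: algebra_simps)
    moreover have "0 \<le> (p - \<alpha>) * (t - s)"
      using \<psi>(3) that by simp
    ultimately have "\<bar>\<psi> (r t) - \<psi> (r s)\<bar> = (p - \<alpha>) * (t - s)"
      by simp
    then show ?thesis
      using w_abs[of "r t" "r s"] r[of s] r[of t] that by (simp add: \<eta>_def)
  qed
  \<comment> \<open>The chosen \<open>r 0\<close> need not be 0, but it has the same level as 0, so
    \<open>w_abs\<close> makes the two points equal.\<close>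
  have start: "\<eta> 0 = w 0"
    using w_abs[of "r 0" 0] r[of 0] \<psi>(1) T by (simp add: \<eta>_def)
  show thesis
  proof (rule that[of \<eta> "r 1"])
    show "ac_curve \<eta>"
      using \<sigma> \<psi>(3) by (intro ac_curve_lipschitz[OF _ lip]) auto
    show "dist (w 0) (\<eta> t) \<le> t / \<sigma> * (p - \<alpha>)" if "t \<in> {0..1}" for t
      using lip[of 0 t] that by (simp add: start dist_commute mult.commute)
  qed (use start r[of 1] in \<open>auto simp: \<eta>_def\<close>)
qed

section \<open>Descent from a given point to the level \<alpha>\<close>

theorem proposition3p4:
  fixes \<Phi> :: "'a::metric_space \<Rightarrow> ereal" and g :: "'a \<Rightarrow> ennreal" and \<alpha> \<beta> \<sigma> :: real
  assumes proper: "eff_dom \<Phi> \<noteq> {}"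
    and bounded_below: "\<exists>c::real. \<forall>u. ereal c \<le> \<Phi> u"
    and "(INF u. \<Phi> u) < ereal \<alpha>" and "(INF u. \<Phi> u) < ereal \<beta>" and "\<alpha> < \<beta>"
    and "upper_gradient \<Phi> g"
    and "{w. ereal \<alpha> < \<Phi> w \<and> \<Phi> w \<le> ereal \<beta>} \<subseteq> flow_start_points \<Phi> g"
    and "\<sigma> > 0"
    and "\<And>w. ereal \<alpha> \<le> \<Phi> w \<Longrightarrow> \<Phi> w \<le> ereal \<beta> \<Longrightarrow> ennreal \<sigma> \<le> g w"
  shows "\<forall>u. \<Phi> u \<le> ereal \<beta> \<longrightarrow>
           (\<exists>\<eta>::real \<Rightarrow> 'a. ac_curve \<eta> \<and>
              \<eta> 0 = u \<and>
              \<Phi> (\<eta> 1) \<le> ereal \<alpha> \<and>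
              (\<forall>t\<in>{0..1}. ereal (dist u (\<eta> t)) \<le> ereal (t / \<sigma>) * max 0 (\<Phi> u - ereal \<alpha>)))"
proof (intro allI impI)
  note ug = \<open>upper_gradient \<Phi> g\<close> and \<sigma> = \<open>\<sigma> > 0\<close>
  fix u assume u: "\<Phi> u \<le> ereal \<beta>"
  show "\<exists>\<eta>::real \<Rightarrow> 'a. ac_curve \<eta> \<and> \<eta> 0 = u \<and> \<Phi> (\<eta> 1) \<le> ereal \<alpha> \<and>
      (\<forall>t\<in>{0..1}. ereal (dist u (\<eta> t)) \<le> ereal (t / \<sigma>) * max 0 (\<Phi> u - ereal \<alpha>))"
  proof (cases "\<Phi> u \<le> ereal \<alpha>")
    case True
    have "ac_curve (\<lambda>_. u)"
      by (rule ac_curve_lipschitz[of 0]) auto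
    moreover have "0 \<le> ereal (t / \<sigma>) * max 0 (\<Phi> u - ereal \<alpha>)" if "t \<in> {0..1}" for t
      using that \<sigma> by (intro ereal_0_le_mult) auto
    ultimately show ?thesis
      using True by (intro exI[of _ "\<lambda>_. u"]) (auto simp: zero_ereal_def)
  next
    case False
    obtain c where c: "\<And>x. ereal c \<le> \<Phi> x"
      using bounded_below by blast
    obtain p where p: "\<Phi> u = ereal p" "\<alpha> < p" "p \<le> \<beta>"
      using False u by (cases "\<Phi> u") auto
    have "u \<in> flow_start_points \<Phi> g"
      using assms(7) False u by auto
    then obtain v where flow: "gradient_flow \<Phi> g v" and v0: "(v \<longlongrightarrow> u) (at_right 0)"
      and \<Phi>0: "((\<lambda>t. \<Phi> (v t)) \<longlongrightarrow> \<Phi> u) (at_right 0)"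
      unfolding flow_start_points_def by blast
    define \<phi> where "\<phi> t = real_of_ereal (\<Phi> (v t))" for t
    have \<phi>: "\<forall>t>0. \<Phi> (v t) = ereal (\<phi> t)"
    proof (intro allI impI)
      fix t :: real assume "t > 0"
      then have "\<Phi> (v t) < \<infinity>"
        using flow by (simp add: gradient_flow_def eff_dom_def)
      then show "\<Phi> (v t) = ereal (\<phi> t)"
        using c[of "v t"] by (cases "\<Phi> (v t)") (auto simp: \<phi>_def)
    qed
    have \<phi>0: "(\<phi> \<longlongrightarrow> p) (at_right 0)"
      using \<Phi>0 unfolding p(1) \<phi>_def[abs_def] by (rule lim_real_of_ereal)
    have near0: "\<forall>\<^sub>F s in at_right 0. 0 < s \<and> s \<le> t" if "t > 0" for t :: real
      unfolding eventually_at_right_field using that by (intro exI[of _ t]) auto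
    \<comment> \<open>Energies along the flow are at most the initial one, hence at most \<beta>.
      Together with a lower bound \<alpha> this places the points where \<open>g\<close> is at least
      \<sigma>.\<close>
    have \<phi>_le: "\<phi> t \<le> p" if "t > 0" for t
    proof (rule tendsto_lowerbound[OF \<phi>0])
      show "\<forall>\<^sub>F s in at_right 0. \<phi> t \<le> \<phi> s"
        using near0[OF that] by eventually_elim (use flow_nonincreasing[OF ug flow \<phi>] in auto)
    qed simp
    have g_ge: "ennreal \<sigma> \<le> g (v r)" if "r > 0" "\<alpha> \<le> \<phi> r" for r
      using \<phi> \<phi>_le[OF that(1)] p(3) that by (intro assms(9)) auto
    obtain T0 where T0: "T0 > 0" "\<phi> T0 \<le> \<alpha>"
    proof (rule ccontr)
      assume "\<not> thesis"
      then have above: "\<alpha> < \<phi> t" if "t > 0" for t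
        using that \<open>\<And>T0. 0 < T0 \<Longrightarrow> \<phi> T0 \<le> \<alpha> \<Longrightarrow> thesis\<close> by force
      \<comment> \<open>By \<open>flow_decrease\<close>, staying above \<alpha> for a time
        \<open>2 * (p - \<alpha>) / \<sigma>\<^sup>2\<close> costs at least
        \<open>p - \<alpha>\<close>, all the energy available. The clock starts at 1 because the
        flow estimates need a positive initial time.\<close>
      define t where "t = 1 + 2 * (p - \<alpha>) / \<sigma>\<^sup>2"
      have t: "1 \<le> t" "\<sigma>\<^sup>2 * (t - 1) = 2 * (p - \<alpha>)"
        using \<sigma> p(2) by (auto simp: t_def)
      have "\<sigma>\<^sup>2 * (t - 1) \<le> 2 * (\<phi> 1 - \<phi> t)"
      proof (rule flow_decrease[OF ug flow \<phi> _ t(1) \<sigma>])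
        fix r assume "r \<in> {1..t}"
        then show "ennreal \<sigma> \<le> g (v r)"
          using above[of r] by (intro g_ge) auto
      qed simp
      then show False
        using t \<phi>_le[of 1] above[of t] by simp
    qed
    \<comment> \<open>The flow lives on positive times and the value \<open>v 0\<close> is
      arbitrary; \<psi> and \<open>w\<close> insert the limits at 0 instead.\<close>
    define \<psi> where "\<psi> t = (if t \<le> 0 then p else \<phi> t)" for t
    define w where "w t = (if t \<le> 0 then u else v t)" for t
    have cont: "continuous_on {0..T0} \<psi>"
      unfolding continuous_on_eq_continuous_within
    proof
      fix x assume x: "x \<in> {0..T0}"
      show "continuous (at x within {0..T0}) \<psi>"
      proof (cases "x = 0")
        case True
        have "(\<psi> \<longlongrightarrow> p) (at_right 0)"
          by (rule Lim_transform_eventually[OF \<phi>0])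
            (use near0[of 1] in \<open>auto simp: \<psi>_def elim: eventually_mono\<close>)
        then show ?thesis
          using True T0(1) by (simp add: continuous_within \<psi>_def at_within_Icc_at_right)
      next
        case False
        then have x: "0 < x" "x \<le> T0" using x by auto
        \<comment> \<open>The interval surrounds \<open>x\<close> even for \<open>x = T0\<close>,
          which gives two-sided continuity, and its positive left end keeps \<psi> equal to
          \<phi>.\<close>
        have "continuous_on {x / 2..T0 + 1} \<phi>"
          using x by (intro flow_continuous_on[OF ug flow \<phi>]) auto
        then have "continuous_on {x / 2<..<T0 + 1} \<phi>"
          by (rule continuous_on_subset) auto
        then have "continuous_on {x / 2<..<T0 + 1} \<psi>"
          by (rule continuous_on_eq) (use x in \<open>auto simp: \<psi>_def\<close>)
        then have "isCont \<psi> x"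
          using x by (simp add: continuous_on_eq_continuous_at)
        then show ?thesis
          by (rule continuous_at_imp_continuous_at_within)
      qed
    qed
    have "\<psi> T0 \<le> \<alpha>" "\<alpha> \<le> \<psi> 0"
      using T0 p(2) by (auto simp: \<psi>_def)
    \<comment> \<open>Any time at level \<alpha> will do: by monotonicity the energy is at least
      \<alpha> up to \<open>T\<close>, so the lower bound on \<open>g\<close> holds there.\<close>
    then obtain T where T: "0 \<le> T" "T \<le> T0" "\<psi> T = \<alpha>"
      using IVT2'[OF _ _ _ cont, of \<alpha>] T0(1) by auto
    then have "T > 0" "\<phi> T = \<alpha>"
      using p(2) by (auto simp: \<psi>_def split: if_splits)
    have above: "\<alpha> \<le> \<phi> r" if "0 < r" "r \<le> T" for r
      using flow_nonincreasing[OF ug flow \<phi> that] \<open>\<phi> T = \<alpha>\<close> by simp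
    have pos: "\<sigma> * dist (v s) (v t) \<le> \<phi> s - \<phi> t" if "0 < s" "s \<le> t" "t \<le> T" for s t
      using that above by (intro flow_dist_le[OF ug flow \<phi> _ _ \<sigma> g_ge]) auto
    \<comment> \<open>The estimate \<open>pos\<close> passes to the limit as \<open>s\<close> tends
      to 0, by convergence of both the curve and its energy to the initial data.\<close>
    have zero: "\<sigma> * dist u (v t) \<le> p - \<phi> t" if "0 < t" "t \<le> T" for t
    proof (rule tendsto_le[OF _ tendsto_diff[OF \<phi>0 tendsto_const] tendsto_mult[OF tendsto_const tendsto_dist[OF v0 tendsto_const]]])
      show "\<forall>\<^sub>F s in at_right 0. \<sigma> * dist (v s) (v t) \<le> \<phi> s - \<phi> t"
        using near0[OF that(1)] by eventually_elim (use pos that in auto)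
    qed simp
    have "\<sigma> * dist (w s) (w t) \<le> \<psi> s - \<psi> t" if "0 \<le> s" "s \<le> t" "t \<le> T" for s t
      using that pos[of s t] zero[of t] by (auto simp: w_def \<psi>_def)
    moreover have "continuous_on {0..T} \<psi>"
      using cont by (rule continuous_on_subset) (use T in auto)
    moreover have "\<psi> 0 = p" by (simp add: \<psi>_def)
    ultimately obtain \<eta> r where \<eta>: "ac_curve \<eta>" "\<eta> 0 = w 0" "\<eta> 1 = w r" "r \<in> {0..T}" "\<psi> r = \<alpha>"
      "\<And>t. t \<in> {0..1} \<Longrightarrow> dist (w 0) (\<eta> t) \<le> t / \<sigma> * (p - \<alpha>)"
      using descent_curve[of \<sigma> T \<psi> p \<alpha> w] \<sigma> T(1,3) p(2) by (metis less_imp_le)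
    have "w 0 = u" by (simp add: w_def)
    \<comment> \<open>The level \<alpha> is strictly below \<open>p\<close>, so \<open>r\<close> is
      a positive time and \<open>w r\<close> lies on the flow.\<close>
    have "r > 0" "\<phi> r = \<alpha>"
      using \<eta>(5) p(2) by (auto simp: \<psi>_def split: if_splits)
    then have "\<Phi> (\<eta> 1) = ereal \<alpha>"
      using \<phi> \<eta>(3) by (simp add: w_def)
    moreover have "ereal (t / \<sigma>) * max 0 (\<Phi> u - ereal \<alpha>) = ereal (t / \<sigma> * (p - \<alpha>))" for t
      using p by (simp add: max_def zero_ereal_def)
    ultimately show ?thesis
      using \<eta> \<open>w 0 = u\<close> by (intro exI[of _ \<eta>]) auto
  qed
qed

end
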